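(* Let $Z_\bullet$ be a finitely generated $\mathrm{FI}$-set and $(X_{t,\bullet},P)$ a connected Markov chain on $Z_\bullet$. Then there exists a virtual relation $\mathrm{Var}$ on $Z_\bullet$ such that for $n\gg0$ the matrix $\mathrm{Var}_n:\mathbb{R}Z_n\to\mathbb{R}Z_n$ with entries $\mathrm{Var}_n(a,b)=\mathrm{Var}(\tau_{a,b})$ (the variance of the hitting time from $a$ to $b$ for $X_{t,n}$) is the specialization of $\mathrm{Var}$ to $n$. In particular, for every stable orbit $\mathcal{O}$ of $Z_\bullet\times Z_\bullet$, the function $n\mapsto\mathrm{Var}_n(\mathcal{O}_n)$ agrees with a rational function of $n$ for all $n\gg0$.
   Context: $\mathrm{FI}$ is the category with objects $[n]=\{1,\dots,n\}$ and injections; an $\mathrm{FI}$-set $Z_\bullet$ is a functor to finite sets with $Z_n$ its value on $[n]$ (with $\mathfrak{S}_n$-action); finitely generated means there is $d$ with $Z_{n+1}=\bigcup_f Z(f)(Z_n)$ over injections $f:[n]\hookrightarrow[n+1]$ for $n\ge d$. For $n\gg0$ the orbit sets $(Z_n\times Z_n)/\mathfrak{S}_n$ are identified with each other via maps induced by injections; a stable orbit $\mathcal{O}$ is a compatible family $(\mathcal{O}_n)_{n\gg0}$ of orbits. $r^{\mathcal{O}}_n$ is the $0/1$ matrix on $\mathbb{R}Z_n$ with $(a,b)$-entry $1$ iff $(a,b)\in\mathcal{O}_n$. A virtual relation is a formal sum $r=\sum_{\mathcal{O}}a_{\mathcal{O}}r^{\mathcal{O}}$ over stable orbits with $a_{\mathcal{O}}\in\mathbb{R}(n)$;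 its specialization to $n\gg0$ is $r_n=\sum a_{\mathcal{O}}(n)r^{\mathcal{O}}_n$. A transition relation is a virtual relation with $a_{\mathcal{O}}(n)\in[0,1]$ and $r_n$ having row sums $1$ for $n\gg0$. A Markov chain on $Z_\bullet$ is a sequence of Markov chains $X_{t,n}$ on $Z_n$ whose transition matrices are, for $n\gg0$, the specializations $P_n$ of a transition relation $P$; connected means irreducible for $n\gg0$. The hitting time $\tau_{a,b}$ is $\min\{t\ge0:X_{t,n}=b\}$ for the chain started at $a$. $\mathrm{Var}_n(\mathcal{O}_n)$ denotes the common value of $\mathrm{Var}_n$ on pairs in $\mathcal{O}_n$. *)

theory Defs
  imports "HOL-Probability.Probability" "HOL-Computational_Algebra.Computational_Algebra"
    "HOL-Computational_Algebra.Field_as_Ring"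
begin

section \<open>FI-sets\<close>

text \<open>Morphisms \<open>[m] \<rightarrow> [n]\<close> of FI, where \<open>[n] = {1..n}\<close>. Injections are taken extensional, so that
  they correspond one to one to HOL functions. By finiteness \<open>FI_hom n n\<close> is the symmetric group
  on \<open>[n]\<close>.\<close>

definition FI_hom :: "nat \<Rightarrow> nat \<Rightarrow> (nat \<Rightarrow> nat) set" where
  "FI_hom m n = {f \<in> {1..m} \<rightarrow>\<^sub>E {1..n}. inj_on f {1..m}}"

text \<open>\<open>FI_map Z m n f\<close> is \<open>Z(f) : Z\<^sub>m \<rightarrow> Z\<^sub>n\<close> for \<open>f : [m] \<rightarrow> [n]\<close>; only its values on \<open>FI_obj Z m\<close>
  are meaningful.\<close>

record 'a FI_data =
  FI_obj :: "nat \<Rightarrow> 'a set"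
  FI_map :: "nat \<Rightarrow> nat \<Rightarrow> (nat \<Rightarrow> nat) \<Rightarrow> 'a \<Rightarrow> 'a"

definition FI_set :: "'a FI_data \<Rightarrow> bool" where
  "FI_set Z \<longleftrightarrow>
     (\<forall>n. finite (FI_obj Z n)) \<and>
     (\<forall>m n. \<forall>f\<in>FI_hom m n. FI_map Z m n f \<in> FI_obj Z m \<rightarrow> FI_obj Z n) \<and>
     (\<forall>n. \<forall>x\<in>FI_obj Z n. FI_map Z n n (restrict id {1..n}) x = x) \<and>
     (\<forall>l m n. \<forall>f\<in>FI_hom l m. \<forall>g\<in>FI_hom m n. \<forall>x\<in>FI_obj Z l.
        FI_map Z l n (compose {1..l} g f) x = FI_map Z m n g (FI_map Z l m f x))"

definition finitely_generated :: "'a FI_data \<Rightarrow> bool" where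
  "finitely_generated Z \<longleftrightarrow>
     (\<exists>d. \<forall>n\<ge>d. FI_obj Z (Suc n) = (\<Union>f\<in>FI_hom n (Suc n). FI_map Z n (Suc n) f ` FI_obj Z n))"

definition FI_prod :: "'a FI_data \<Rightarrow> 'b FI_data \<Rightarrow> ('a \<times> 'b) FI_data" where
  "FI_prod Y Z = \<lparr>FI_obj = (\<lambda>n. FI_obj Y n \<times> FI_obj Z n),
                  FI_map = (\<lambda>m n f. map_prod (FI_map Y m n f) (FI_map Z m n f))\<rparr>"


section \<open>Stable orbits\<close>

definition orbit_rel :: "'a FI_data \<Rightarrow> nat \<Rightarrow> ('a \<times> 'a) set" where
  "orbit_rel Z n = {(x, FI_map Z n n \<sigma> x) | x \<sigma>. x \<in> FI_obj Z n \<and> \<sigma> \<in> FI_hom n n}"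

definition orbits :: "'a FI_data \<Rightarrow> nat \<Rightarrow> 'a set set" where
  "orbits Z n = FI_obj Z n // orbit_rel Z n"

text \<open>The map \<open>Z\<^sub>n/S\<^sub>n \<rightarrow> Z\<^sub>n\<^sub>+\<^sub>1/S\<^sub>n\<^sub>+\<^sub>1\<close> induced by any injection \<open>f : [n] \<rightarrow> [n+1]\<close>. All these injections
  form one orbit under \<open>S\<^sub>n\<^sub>+\<^sub>1\<close>, so the orbit containing \<open>Z(f)(X)\<close> is the union below.\<close>

definition orbit_map :: "'a FI_data \<Rightarrow> nat \<Rightarrow> 'a set \<Rightarrow> 'a set" where
  "orbit_map Z n X = (\<Union>f\<in>FI_hom n (Suc n). FI_map Z n (Suc n) f ` X)"

text \<open>Least index from which on all the induced maps identify the orbit sets. It exists for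
  finitely generated FI-sets: the induced maps are then eventually surjections of finite sets.\<close>

definition stable_start :: "'a FI_data \<Rightarrow> nat" where
  "stable_start Z =
     (LEAST N. \<forall>n\<ge>N. bij_betw (orbit_map Z n) (orbits Z n) (orbits Z (Suc n)))"

text \<open>A stable orbit is a compatible family indexed by the stable range. The value \<open>{}\<close> below
  that range is a dummy, ensuring that each stable orbit is represented by exactly one function.\<close>

definition stable_orbits :: "'a FI_data \<Rightarrow> (nat \<Rightarrow> 'a set) set" where
  "stable_orbits Z =
     {\<O>. (\<forall>n\<ge>stable_start Z. \<O> n \<in> orbits Z n \<and> \<O> (Suc n) = orbit_map Z n (\<O> n)) \<and>
         (\<forall>n<stable_start Z. \<O> n = {})}"


section \<open>Virtual relations\<close>

text \<open>\<open>\<real>(n)\<close> is the type \<open>real poly fract\<close>. Evaluation uses the reduced representation, so it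
  is the correct value at every point that is not a pole.\<close>

definition eval_ratfun :: "real poly fract \<Rightarrow> real \<Rightarrow> real" where
  "eval_ratfun r x = poly (fst (quot_of_fract r)) x / poly (snd (quot_of_fract r)) x"

type_synonym 'a family = "nat \<Rightarrow> ('a \<times> 'a) set"

text \<open>A formal sum over stable orbits of \<open>Z \<times> Z\<close>, given by its coefficients.\<close>

definition virtual_relation :: "'a FI_data \<Rightarrow> ('a family \<Rightarrow> real poly fract) \<Rightarrow> bool" where
  "virtual_relation Z r \<longleftrightarrow> (\<forall>\<O>. \<O> \<notin> stable_orbits (FI_prod Z Z) \<longrightarrow> r \<O> = 0)"

definition orbit_matrix :: "'a family \<Rightarrow> nat \<Rightarrow> 'a \<Rightarrow> 'a \<Rightarrow> real" where
  "orbit_matrix \<O> n a b = of_bool ((a, b) \<in> \<O> n)"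

definition specialize ::
  "'a FI_data \<Rightarrow> ('a family \<Rightarrow> real poly fract) \<Rightarrow> nat \<Rightarrow> 'a \<Rightarrow> 'a \<Rightarrow> real" where
  "specialize Z r n a b =
     (\<Sum>\<O>\<in>stable_orbits (FI_prod Z Z). eval_ratfun (r \<O>) (real n) * orbit_matrix \<O> n a b)"

definition transition_relation :: "'a FI_data \<Rightarrow> ('a family \<Rightarrow> real poly fract) \<Rightarrow> bool" where
  "transition_relation Z P \<longleftrightarrow>
     virtual_relation Z P \<and>
     (\<forall>\<^sub>F n in sequentially.
        (\<forall>\<O>\<in>stable_orbits (FI_prod Z Z). eval_ratfun (P \<O>) (real n) \<in> {0..1}) \<and>
        (\<forall>a\<in>FI_obj Z n. (\<Sum>b\<in>FI_obj Z n. specialize Z P n a b) = 1))"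


section \<open>Markov chains\<close>

definition stochastic_matrix :: "'a set \<Rightarrow> ('a \<Rightarrow> 'a \<Rightarrow> real) \<Rightarrow> bool" where
  "stochastic_matrix S Q \<longleftrightarrow>
     (\<forall>a\<in>S. \<forall>b\<in>S. 0 \<le> Q a b) \<and> (\<forall>a\<in>S. (\<Sum>b\<in>S. Q a b) = 1)"

text \<open>Time-homogeneous Markov chain with finite state space \<open>S\<close> and transition matrix \<open>Q\<close>,
  started at \<open>a\<close>.\<close>

definition markov_chain_from ::
  "'a set \<Rightarrow> ('a \<Rightarrow> 'a \<Rightarrow> real) \<Rightarrow> 'a \<Rightarrow> 'w measure \<Rightarrow> (nat \<Rightarrow> 'w \<Rightarrow> 'a) \<Rightarrow> bool" where
  "markov_chain_from S Q a M X \<longleftrightarrow>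
     prob_space M \<and>
     (\<forall>t. X t \<in> measurable M (count_space S)) \<and>
     (AE \<omega> in M. X 0 \<omega> = a) \<and>
     (\<forall>t x. \<forall>y\<in>S. \<P>(\<omega> in M. \<forall>s\<le>t. X s \<omega> = x s) > 0 \<longrightarrow>
        \<P>(\<omega> in M. X (Suc t) \<omega> = y \<bar> \<forall>s\<le>t. X s \<omega> = x s) = Q (x t) y)"

text \<open>\<open>X n t\<close> is the state of the \<open>n\<close>-th chain at time \<open>t\<close>, and \<open>M n a\<close> is the probability measure
  under which this chain is started at \<open>a\<close>.\<close>

definition FI_markov_chain ::
  "'a FI_data \<Rightarrow> (nat \<Rightarrow> 'a \<Rightarrow> 'w measure) \<Rightarrow> (nat \<Rightarrow> nat \<Rightarrow> 'w \<Rightarrow> 'a) \<Rightarrow>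
   ('a family \<Rightarrow> real poly fract) \<Rightarrow> bool" where
  "FI_markov_chain Z M X P \<longleftrightarrow>
     transition_relation Z P \<and>
     (\<exists>Q. (\<forall>n. stochastic_matrix (FI_obj Z n) (Q n) \<and>
               (\<forall>a\<in>FI_obj Z n. markov_chain_from (FI_obj Z n) (Q n) a (M n a) (X n))) \<and>
          (\<forall>\<^sub>F n in sequentially.
             \<forall>a\<in>FI_obj Z n. \<forall>b\<in>FI_obj Z n. Q n a b = specialize Z P n a b))"

fun matrix_pow :: "'a set \<Rightarrow> ('a \<Rightarrow> 'a \<Rightarrow> real) \<Rightarrow> nat \<Rightarrow> 'a \<Rightarrow> 'a \<Rightarrow> real" where
  "matrix_pow S Q 0 a b = of_bool (a = b)"
| "matrix_pow S Q (Suc t) a b = (\<Sum>c\<in>S. Q a c * matrix_pow S Q t c b)"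

definition irreducible_matrix :: "'a set \<Rightarrow> ('a \<Rightarrow> 'a \<Rightarrow> real) \<Rightarrow> bool" where
  "irreducible_matrix S Q \<longleftrightarrow> (\<forall>a\<in>S. \<forall>b\<in>S. \<exists>t. matrix_pow S Q t a b > 0)"

definition connected_chain :: "'a FI_data \<Rightarrow> ('a family \<Rightarrow> real poly fract) \<Rightarrow> bool" where
  "connected_chain Z P \<longleftrightarrow>
     (\<forall>\<^sub>F n in sequentially. irreducible_matrix (FI_obj Z n) (specialize Z P n))"

definition hitting_time :: "(nat \<Rightarrow> 'w \<Rightarrow> 'a) \<Rightarrow> 'a \<Rightarrow> 'w \<Rightarrow> enat" where
  "hitting_time X b \<omega> = (if \<exists>t. X t \<omega> = b then enat (LEAST t. X t \<omega> = b) else \<infinity>)"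

text \<open>The finiteness conditions exclude the default value 0 that \<open>variance\<close> takes on functions
  that are not integrable.\<close>

definition has_variance :: "'w measure \<Rightarrow> ('w \<Rightarrow> enat) \<Rightarrow> real \<Rightarrow> bool" where
  "has_variance M T v \<longleftrightarrow>
     (AE \<omega> in M. T \<omega> \<noteq> \<infinity>) \<and>
     integrable M (\<lambda>\<omega>. (real (the_enat (T \<omega>)))\<^sup>2) \<and>
     prob_space.variance M (\<lambda>\<omega>. real (the_enat (T \<omega>))) = v"

end

theory Submission
  imports Defs
begin

text \<open>For a fixed target \<open>b\<close> let \<open>R\<close> be the transition operator killed at \<open>b\<close>. Then
  \<open>h = \<Sum>\<^sub>t R\<^sup>t 1\<close> is the mean hitting time, and with \<open>k = \<Sum>\<^sub>t R\<^sup>t h\<close> the second moment is \<open>2 k - h\<close>. Both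
  \<open>h\<close> and \<open>k\<close> are invariant under the symmetric group, hence functions on the finite set of stable
  orbits of \<open>Z \<times> Z\<close>, where they are the unique solutions of linear systems \<open>(I - R) h = 1\<close> and
  \<open>(I - R) k = h\<close> of fixed size. The coefficients are built from the entries of \<open>P\<close> and from the
  numbers of \<open>c\<close> with \<open>(a, c) \<in> \<O>1\<close> and \<open>(c, b) \<in> \<O>2\<close> for \<open>(a, b) \<in> \<O>\<close>. These are quotients of
  cardinalities of invariant subsets of \<open>Z \<times> Z \<times> Z\<close> and \<open>Z \<times> Z\<close>, and such cardinalities are
  eventually polynomial in \<open>n\<close>: an orbit eventually has \<open>(n choose j) * c\<close> elements, where \<open>j\<close> is the
  size of the minimal support of its elements. Gaussian elimination then shows that the solutions
  are eventually rational in \<open>n\<close>.\<close>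

section \<open>Eventually rational functions\<close>

text \<open>Irreducibility is known for each large \<open>n\<close> separately, and the decay of the
  killed chain may slow down as \<open>n\<close> grows, so no estimate is uniform in
  \<open>n\<close>. It makes the moments finite and the systems uniquely solvable at each single
  \<open>n\<close>; a formula valid for all large \<open>n\<close> comes from algebra alone, by
  choosing the same pivots for all of them. A second obstacle is that the maps \<open>Z(f)\<close>
  need not be injective: orbits may lose elements and supports may shrink before they settle, and
  two supports of an element meet in a support only if some point of \<open>[n]\<close> lies outside
  both. Hence supports are compared only for \<open>n\<close> large relative to the stage where the
  orbit starts. The combination \<open>2 k - h\<close> arises because the square of the hitting time
  is the sum of \<open>2 t + 1\<close> over the times \<open>t\<close> before it, while the double
  sum defining \<open>k\<close> contains \<open>R\<^sup>t 1\<close> exactly \<open>t + 1\<close>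
  times.\<close>

definition eventually_rational :: "(nat \<Rightarrow> real) \<Rightarrow> bool" where
  "eventually_rational f \<longleftrightarrow>
     (\<exists>p q :: real poly. q \<noteq> 0 \<and> (\<forall>\<^sub>F n in sequentially. f n = poly p (real n) / poly q (real n)))"

lemma eventually_poly_nonzero:
  fixes q :: "real poly"
  assumes "q \<noteq> 0"
  shows "\<forall>\<^sub>F n in sequentially. poly q (real n) \<noteq> 0"
proof -
  have "finite (real -` {x. poly q x = 0})"
    using poly_roots_finite[OF assms] by (intro finite_vimageI) (auto simp: inj_on_def)
  then obtain N where "\<forall>n\<in>real -` {x. poly q x = 0}. n < N"
    using finite_nat_set_iff_bounded by blast
  then show ?thesis
    unfolding eventually_sequentially by (intro exI[of _ N]) (auto simp: not_less[symmetric])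
qed

lemma eventually_rational_cong:
  assumes "eventually_rational f" "\<forall>\<^sub>F n in sequentially. g n = f n"
  shows "eventually_rational g"
proof -
  obtain p q where "q \<noteq> 0" "\<forall>\<^sub>F n in sequentially. f n = poly p (real n) / poly q (real n)"
    using assms(1) by (auto simp: eventually_rational_def)
  moreover from this(2) assms(2)
  have "\<forall>\<^sub>F n in sequentially. g n = poly p (real n) / poly q (real n)"
    by eventually_elim simp
  ultimately show ?thesis by (auto simp: eventually_rational_def)
qed

lemma eventually_rational_poly: "eventually_rational (\<lambda>n. poly p (real n))"
  unfolding eventually_rational_def by (intro exI[of _ p] exI[of _ 1]) simp

lemma eventually_rational_const: "eventually_rational (\<lambda>_. c)"
  using eventually_rational_poly[of "[:c:]"] by simp

lemma eventually_rational_of_nat: "eventually_rational real"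
  using eventually_rational_poly[of "[:0, 1:]"] by simp

lemma eventually_rational_eval_ratfun: "eventually_rational (\<lambda>n. eval_ratfun r (real n))"
  unfolding eventually_rational_def eval_ratfun_def
  by (intro exI[of _ "fst (quot_of_fract r)"] exI[of _ "snd (quot_of_fract r)"]) simp

lemma eventually_rational_add:
  assumes "eventually_rational f" "eventually_rational g"
  shows "eventually_rational (\<lambda>n. f n + g n)"
proof -
  obtain p q where q: "q \<noteq> 0" and f: "\<forall>\<^sub>F n in sequentially. f n = poly p (real n) / poly q (real n)"
    using assms(1) by (auto simp: eventually_rational_def)
  obtain p' q' where q': "q' \<noteq> 0"
    and g: "\<forall>\<^sub>F n in sequentially. g n = poly p' (real n) / poly q' (real n)"
    using assms(2) by (auto simp: eventually_rational_def)
  have "\<forall>\<^sub>F n in sequentially. f n + g n = poly (p * q' + p' * q) (real n) / poly (q * q') (real n)"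
    using f g eventually_poly_nonzero[OF q] eventually_poly_nonzero[OF q']
    by eventually_elim (simp add: field_simps)
  then show ?thesis
    unfolding eventually_rational_def using q q' by (metis mult_eq_0_iff)
qed

lemma eventually_rational_mult:
  assumes "eventually_rational f" "eventually_rational g"
  shows "eventually_rational (\<lambda>n. f n * g n)"
proof -
  obtain p q where q: "q \<noteq> 0" and f: "\<forall>\<^sub>F n in sequentially. f n = poly p (real n) / poly q (real n)"
    using assms(1) by (auto simp: eventually_rational_def)
  obtain p' q' where q': "q' \<noteq> 0"
    and g: "\<forall>\<^sub>F n in sequentially. g n = poly p' (real n) / poly q' (real n)"
    using assms(2) by (auto simp: eventually_rational_def)
  have "\<forall>\<^sub>F n in sequentially. f n * g n = poly (p * p') (real n) / poly (q * q') (real n)"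
    using f g by eventually_elim simp
  then show ?thesis
    unfolding eventually_rational_def using q q' by (metis mult_eq_0_iff)
qed

lemma eventually_rational_inverse:
  assumes "eventually_rational f"
  shows "eventually_rational (\<lambda>n. inverse (f n))"
proof -
  obtain p q where q: "q \<noteq> 0" and f: "\<forall>\<^sub>F n in sequentially. f n = poly p (real n) / poly q (real n)"
    using assms by (auto simp: eventually_rational_def)
  show ?thesis
  proof (cases "p = 0")
    case True
    then have "\<forall>\<^sub>F n in sequentially. inverse (f n) = 0"
      using f by simp
    then show ?thesis
      using eventually_rational_cong[OF eventually_rational_const[of 0]] by simp
  next
    case False
    have "\<forall>\<^sub>F n in sequentially. inverse (f n) = poly q (real n) / poly p (real n)"
      using f by eventually_elim (simp add: inverse_eq_divide)
    then show ?thesis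
      unfolding eventually_rational_def using False by blast
  qed
qed

lemma eventually_rational_diff:
  assumes "eventually_rational f" "eventually_rational g"
  shows "eventually_rational (\<lambda>n. f n - g n)"
  using eventually_rational_add[OF assms(1)
      eventually_rational_mult[OF eventually_rational_const[of "-1"] assms(2)]]
  by simp

lemma eventually_rational_divide:
  assumes "eventually_rational f" "eventually_rational g"
  shows "eventually_rational (\<lambda>n. f n / g n)"
  using eventually_rational_mult[OF assms(1) eventually_rational_inverse[OF assms(2)]]
  by (simp add: divide_inverse)

lemma eventually_rational_sum:
  assumes "\<And>i. i \<in> I \<Longrightarrow> eventually_rational (f i)"
  shows "eventually_rational (\<lambda>n. \<Sum>i\<in>I. f i n)"
  using assms
  by (induction I rule: infinite_finite_induct)
     (auto intro: eventually_rational_const eventually_rational_add)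

lemma eventually_rational_prod:
  assumes "\<And>i. i \<in> I \<Longrightarrow> eventually_rational (f i)"
  shows "eventually_rational (\<lambda>n. \<Prod>i\<in>I. f i n)"
  using assms
  by (induction I rule: infinite_finite_induct)
     (auto intro: eventually_rational_const eventually_rational_mult)

lemma eventually_rational_binomial: "eventually_rational (\<lambda>n. real (n choose k))"
proof -
  have "eventually_rational (\<lambda>n. (\<Prod>i\<in>{0..<k}. real n - real i) / fact k)"
    by (intro eventually_rational_divide eventually_rational_prod eventually_rational_diff
        eventually_rational_of_nat eventually_rational_const)
  then show ?thesis
    by (simp add: binomial_gbinomial gbinomial_prod_rev)
qed

text \<open>A nonzero polynomial has finitely many roots, which makes the germs at infinity a field.
  In the elimination this turns an entry that is not eventually zero into a pivot invertible for all
  large \<open>n\<close>.\<close>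

lemma eventually_rational_zero_or_nonzero:
  assumes "eventually_rational f"
  shows "(\<forall>\<^sub>F n in sequentially. f n = 0) \<or> (\<forall>\<^sub>F n in sequentially. f n \<noteq> 0)"
proof -
  obtain p q where q: "q \<noteq> 0" and f: "\<forall>\<^sub>F n in sequentially. f n = poly p (real n) / poly q (real n)"
    using assms by (auto simp: eventually_rational_def)
  show ?thesis
  proof (cases "p = 0")
    case True
    then show ?thesis using f by simp
  next
    case False
    have "\<forall>\<^sub>F n in sequentially. f n \<noteq> 0"
      using f eventually_poly_nonzero[OF q] eventually_poly_nonzero[OF False]
      by eventually_elim simp
    then show ?thesis ..
  qed
qed

text \<open>\<open>eval_ratfun\<close> evaluates the reduced fraction,
  \<open>eventually_rational\<close> an arbitrary one. By cross-multiplication they can disagree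
  only at the finitely many roots of the two denominators.\<close>

lemma eventually_rational_iff_eval_ratfun:
  "eventually_rational f \<longleftrightarrow> (\<exists>r. \<forall>\<^sub>F n in sequentially. f n = eval_ratfun r (real n))"
proof
  assume "eventually_rational f"
  then obtain p q where q: "q \<noteq> 0"
    and f: "\<forall>\<^sub>F n in sequentially. f n = poly p (real n) / poly q (real n)"
    by (auto simp: eventually_rational_def)
  define r where "r = Fract p q"
  define p' q' where "p' = fst (quot_of_fract r)" and "q' = snd (quot_of_fract r)"
  have q': "q' \<noteq> 0" by (simp add: q'_def)
  have "Fract p q = Fract p' q'"
    by (simp add: p'_def q'_def r_def)
  then have cross: "p * q' = p' * q"
    using q q' eq_fract(1) by blast
  have "\<forall>\<^sub>F n in sequentially. f n = eval_ratfun r (real n)"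
    using f eventually_poly_nonzero[OF q] eventually_poly_nonzero[OF q']
  proof eventually_elim
    case (elim n)
    have "poly p (real n) * poly q' (real n) = poly p' (real n) * poly q (real n)"
      using cross by (metis poly_mult)
    then show ?case
      using elim by (simp add: eval_ratfun_def p'_def[symmetric] q'_def[symmetric] frac_eq_eq)
  qed
  then show "\<exists>r. \<forall>\<^sub>F n in sequentially. f n = eval_ratfun r (real n)" ..
next
  assume "\<exists>r. \<forall>\<^sub>F n in sequentially. f n = eval_ratfun r (real n)"
  then show "eventually_rational f"
    using eventually_rational_cong eventually_rational_eval_ratfun by metis
qed

text \<open>Gaussian elimination over the functions that are eventually rational, which behave like a field
  because each of them is eventually zero or eventually nonzero.\<close>

lemma eventually_rational_unique_solution:
  fixes A :: "'i \<Rightarrow> 'j \<Rightarrow> nat \<Rightarrow> real"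
  assumes "finite J" and I: "finite I"
    and "\<And>i j. i \<in> I \<Longrightarrow> j \<in> J \<Longrightarrow> eventually_rational (A i j)"
    and "\<And>i. i \<in> I \<Longrightarrow> eventually_rational (v i)"
    and "\<forall>\<^sub>F n in sequentially. \<forall>i\<in>I. (\<Sum>j\<in>J. A i j n * x j n) = v i n"
    and "\<forall>\<^sub>F n in sequentially. \<forall>z.
           (\<forall>i\<in>I. (\<Sum>j\<in>J. A i j n * z j) = 0) \<longrightarrow> (\<forall>j\<in>J. z j = 0)"
    and "j \<in> J"
  shows "eventually_rational (x j)"
  using assms(1,3-)
proof (induction J arbitrary: A v j rule: finite_induct)
  case empty
  then show ?case by simp
next
  case (insert k J)
  note sol = insert.prems(3) and uniq = insert.prems(4)
  note sum_insert = sum.insert[OF insert.hyps]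
  \<comment> \<open>If the column of \<open>k\<close> were eventually zero, the unit vector at
    \<open>k\<close> would contradict uniqueness.\<close>
  have "\<exists>i\<in>I. \<forall>\<^sub>F n in sequentially. A i k n \<noteq> 0"
  proof (rule ccontr)
    assume "\<not> ?thesis"
    then have "\<forall>i\<in>I. \<forall>\<^sub>F n in sequentially. A i k n = 0"
      using eventually_rational_zero_or_nonzero insert.prems(1) by blast
    then have "\<forall>\<^sub>F n in sequentially. \<forall>i\<in>I. A i k n = 0"
      using I by (simp add: eventually_ball_finite)
    with uniq have "\<forall>\<^sub>F n in sequentially. False"
    proof eventually_elim
      case (elim n)
      have "(\<Sum>j\<in>insert k J. A i j n * of_bool (j = k)) = 0" if "i \<in> I" for i
        using elim(2) that insert.hyps by (auto intro!: sum.neutral)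
      then show ?case using elim(1)[rule_format, of "\<lambda>j. of_bool (j = k)" k] by simp
    qed
    then show False by simp
  qed
  then obtain r where r: "r \<in> I" and pivot: "\<forall>\<^sub>F n in sequentially. A r k n \<noteq> 0" by blast
  \<comment> \<open>The pivot row \<open>r\<close> stays in \<open>I\<close> and becomes a zero
    equation, so the induction runs over the unknowns and the set of equations never
    changes.\<close>
  define B where "B i j n = A i j n - A i k n / A r k n * A r j n" for i j n
  define w where "w i n = v i n - A i k n / A r k n * v r n" for i n
  have B: "eventually_rational (B i j)" if "i \<in> I" "j \<in> J" for i j
    unfolding B_def using that r insert.prems(1)
    by (intro eventually_rational_diff eventually_rational_mult eventually_rational_divide) auto
  have w: "eventually_rational (w i)" if "i \<in> I" for i
    unfolding w_def using that r insert.prems(1,2)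
    by (intro eventually_rational_diff eventually_rational_mult eventually_rational_divide) auto
  have sum_B: "(\<Sum>j\<in>J. B i j n * z j) =
      (\<Sum>j\<in>J. A i j n * z j) - A i k n / A r k n * (\<Sum>j\<in>J. A r j n * z j)" for i n z
    by (simp add: B_def algebra_simps sum_subtractf sum_distrib_left)
  have xk: "\<forall>\<^sub>F n in sequentially. x k n = (v r n - (\<Sum>j\<in>J. A r j n * x j n)) / A r k n"
    using sol pivot
  proof eventually_elim
    case (elim n)
    have "A r k n * x k n + (\<Sum>j\<in>J. A r j n * x j n) = v r n"
      using elim(1) r sum_insert by metis
    then show ?case using elim(2) by (simp add: field_simps)
  qed
  have solB: "\<forall>\<^sub>F n in sequentially. \<forall>i\<in>I. (\<Sum>j\<in>J. B i j n * x j n) = w i n"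
    using sol pivot
  proof eventually_elim
    case (elim n)
    have "A i k n * x k n + (\<Sum>j\<in>J. A i j n * x j n) = v i n" if "i \<in> I" for i
      using elim(1) that sum_insert by metis
    then have eq: "(\<Sum>j\<in>J. A i j n * x j n) = v i n - A i k n * x k n" if "i \<in> I" for i
      using that by (metis add_diff_cancel_left')
    show ?case
    proof
      fix i
      assume "i \<in> I"
      then show "(\<Sum>j\<in>J. B i j n * x j n) = w i n"
        unfolding sum_B w_def eq[OF \<open>i \<in> I\<close>] eq[OF r] using elim(2) by (simp add: algebra_simps)
    qed
  qed
  have uniqB: "\<forall>\<^sub>F n in sequentially. \<forall>z.
      (\<forall>i\<in>I. (\<Sum>j\<in>J. B i j n * z j) = 0) \<longrightarrow> (\<forall>j\<in>J. z j = 0)"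
    using uniq pivot
  proof eventually_elim
    case (elim n)
    show ?case
    proof (intro allI impI ballI)
      fix z j
      assume z: "\<forall>i\<in>I. (\<Sum>j\<in>J. B i j n * z j) = 0" and j: "j \<in> J"
      \<comment> \<open>Solving the pivot row for the coordinate \<open>k\<close> extends a kernel
        vector of the reduced system to one of the full system.\<close>
      define z' where "z' = z(k := - (\<Sum>j\<in>J. A r j n * z j) / A r k n)"
      have same: "(\<Sum>j\<in>J. A i j n * z' j) = (\<Sum>j\<in>J. A i j n * z j)" for i
        using insert.hyps by (intro sum.cong) (auto simp: z'_def)
      have "(\<Sum>j\<in>insert k J. A i j n * z' j) = 0" if "i \<in> I" for i
        using z that unfolding sum_B sum_insert same by (simp add: z'_def)
      then have "z' j = 0" using elim(1) j by blast
      then show "z j = 0" using j insert.hyps by (auto simp: z'_def split: if_splits)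
    qed
  qed
  have J: "eventually_rational (x j)" if "j \<in> J" for j
    using insert.IH[OF B w solB uniqB that] by simp
  have "eventually_rational (x k)"
    using r insert.prems(1,2) J
    by (intro eventually_rational_cong[OF _ xk] eventually_rational_divide
        eventually_rational_diff eventually_rational_sum eventually_rational_mult) auto
  then show ?case using J insert.prems(5) by auto
qed


section \<open>Moments of hitting times\<close>

text \<open>The operator acts on functions of the initial state. Only the row of \<open>b\<close> is
  deleted; the column of \<open>b\<close> does no harm since the functions of interest vanish at
  \<open>b\<close>.\<close>

definition killed_step :: "'a set \<Rightarrow> ('a \<Rightarrow> 'a \<Rightarrow> real) \<Rightarrow> 'a \<Rightarrow> ('a \<Rightarrow> real) \<Rightarrow> 'a \<Rightarrow> real" where
  "killed_step S Q b w x = (if x = b then 0 else \<Sum>c\<in>S. Q x c * w c)"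

text \<open>The probability that the hitting time of \<open>b\<close> exceeds \<open>t\<close>, as a
  function of the initial state; see \<open>markov_chain_avoid_prob\<close>.\<close>

definition survival :: "'a set \<Rightarrow> ('a \<Rightarrow> 'a \<Rightarrow> real) \<Rightarrow> 'a \<Rightarrow> nat \<Rightarrow> 'a \<Rightarrow> real" where
  "survival S Q b t = (killed_step S Q b ^^ t) (\<lambda>x. of_bool (x \<noteq> b))"

text \<open>The Green operator, inverse to \<open>I - R\<close> on functions vanishing at
  \<open>b\<close>.\<close>

definition potential :: "'a set \<Rightarrow> ('a \<Rightarrow> 'a \<Rightarrow> real) \<Rightarrow> 'a \<Rightarrow> ('a \<Rightarrow> real) \<Rightarrow> 'a \<Rightarrow> real" where
  "potential S Q b w x = (\<Sum>t. (killed_step S Q b ^^ t) w x)"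

definition hit_mean :: "'a set \<Rightarrow> ('a \<Rightarrow> 'a \<Rightarrow> real) \<Rightarrow> 'a \<Rightarrow> 'a \<Rightarrow> real" where
  "hit_mean S Q b = potential S Q b (\<lambda>x. of_bool (x \<noteq> b))"

text \<open>Not the second moment itself: for the hitting time \<tau> this is the expectation of
  \<tau> (\<tau> + 1) / 2.\<close>

definition hit_second :: "'a set \<Rightarrow> ('a \<Rightarrow> 'a \<Rightarrow> real) \<Rightarrow> 'a \<Rightarrow> 'a \<Rightarrow> real" where
  "hit_second S Q b = potential S Q b (hit_mean S Q b)"

section \<open>Convergence and uniqueness for the chain killed at its target\<close>

locale killed_chain =
  fixes S :: "'a set" and Q :: "'a \<Rightarrow> 'a \<Rightarrow> real" and b :: 'a
  assumes finite_S: "finite S" and stochastic: "stochastic_matrix S Q"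
    and irreducible: "irreducible_matrix S Q" and b_in: "b \<in> S"
begin

abbreviation "R \<equiv> killed_step S Q b"
abbreviation "U \<equiv> survival S Q b"
abbreviation "G \<equiv> potential S Q b"
abbreviation "H \<equiv> hit_mean S Q b"
abbreviation "K \<equiv> hit_second S Q b"

lemma Q_nonneg: "x \<in> S \<Longrightarrow> y \<in> S \<Longrightarrow> 0 \<le> Q x y"
  and Q_sum: "x \<in> S \<Longrightarrow> (\<Sum>y\<in>S. Q x y) = 1"
  using stochastic by (auto simp: stochastic_matrix_def)

lemma R_pow_mono:
  assumes "\<And>x. x \<in> S \<Longrightarrow> w x \<le> w' x" "x \<in> S"
  shows "(R ^^ t) w x \<le> (R ^^ t) w' x"
  using assms(2)
proof (induction t arbitrary: x)
  case (Suc t)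
  then show ?case
    by (auto simp: killed_step_def intro!: sum_mono mult_left_mono Q_nonneg)
qed (use assms(1) in auto)

lemma R_pow_cong:
  assumes "\<And>x. x \<in> S \<Longrightarrow> w x = w' x" "x \<in> S"
  shows "(R ^^ t) w x = (R ^^ t) w' x"
  using R_pow_mono[of w w' x t] R_pow_mono[of w' w x t] assms by force

lemma R_pow_mult: "(R ^^ t) (\<lambda>x. c * w x) x = c * (R ^^ t) w x"
  by (induction t arbitrary: x) (auto simp: killed_step_def sum_distrib_left mult.left_commute)

lemma R_pow_add: "(R ^^ t) (\<lambda>x. w x + w' x) x = (R ^^ t) w x + (R ^^ t) w' x"
  by (induction t arbitrary: x) (auto simp: killed_step_def sum.distrib distrib_left)

lemma U_0: "U 0 x = of_bool (x \<noteq> b)"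
  by (simp add: survival_def)

lemma U_Suc: "U (Suc t) x = R (U t) x"
  by (simp add: survival_def)

lemma U_nonneg: "x \<in> S \<Longrightarrow> 0 \<le> U t x"
proof (induction t arbitrary: x)
  case (Suc t)
  then show ?case by (auto simp: U_Suc killed_step_def intro!: sum_nonneg mult_nonneg_nonneg Q_nonneg)
qed (simp add: U_0)

lemma matrix_pow_nonneg: "x \<in> S \<Longrightarrow> y \<in> S \<Longrightarrow> 0 \<le> matrix_pow S Q t x y"
  by (induction t arbitrary: x) (auto intro!: sum_nonneg mult_nonneg_nonneg Q_nonneg)

text \<open>Being at \<open>b\<close> at time \<open>t\<close> excludes having avoided
  \<open>b\<close> up to \<open>t\<close>. Through this inequality irreducibility, which speaks of
  powers of \<open>Q\<close>, bounds survival away from 1.\<close>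

lemma U_le_matrix_pow:
  assumes "x \<in> S"
  shows "U t x \<le> 1 - matrix_pow S Q t x b"
  using assms
proof (induction t arbitrary: x)
  case (Suc t)
  have "(\<Sum>c\<in>S. Q x c * U t c) \<le> (\<Sum>c\<in>S. Q x c * (1 - matrix_pow S Q t c b))"
    using Suc by (intro sum_mono mult_left_mono Q_nonneg) auto
  also have "\<dots> = 1 - matrix_pow S Q (Suc t) x b"
    using Q_sum[OF Suc.prems] by (simp add: algebra_simps sum_subtractf)
  finally have le: "(\<Sum>c\<in>S. Q x c * U t c) \<le> 1 - matrix_pow S Q (Suc t) x b" .
  have "0 \<le> (\<Sum>c\<in>S. Q x c * U t c)"
    using Suc.prems by (intro sum_nonneg mult_nonneg_nonneg Q_nonneg U_nonneg)
  then show ?case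
    using le by (auto simp: U_Suc killed_step_def)
qed (simp add: U_0)

lemma U_le_1: "x \<in> S \<Longrightarrow> U t x \<le> 1"
  using U_le_matrix_pow[of x t] matrix_pow_nonneg[of x b t] b_in by simp

lemma R_pow_U: "(R ^^ s) (U t) = U (s + t)"
  by (simp add: survival_def funpow_add)

lemma U_decreasing:
  assumes "x \<in> S"
  shows "U (t + s) x \<le> U t x"
proof -
  have "U s y \<le> U 0 y" if "y \<in> S" for y
  proof (cases "y = b")
    case True
    then show ?thesis
      by (cases s) (simp_all add: U_0 U_Suc killed_step_def)
  qed (use U_le_1 that in \<open>simp add: U_0\<close>)
  then have "(R ^^ t) (U s) x \<le> (R ^^ t) (U 0) x"
    using assms by (intro R_pow_mono)
  then show ?thesis by (simp add: R_pow_U)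
qed

text \<open>Every state is at \<open>b\<close> with positive probability at some time. Survival
  decreases in time, so the largest of these times serves all states at once, and the maximum of
  survival over the finite state space is below 1. The bound \<open>U T \<le> \<rho> * U 0\<close>,
  both sides vanishing at \<open>b\<close>, is then carried to all times by the positive operator
  \<open>R\<close>.\<close>

lemma U_contraction:
  "\<exists>T \<rho>. \<rho> < 1 \<and> 0 \<le> \<rho> \<and> (\<forall>t. \<forall>x\<in>S. U (t + T) x \<le> \<rho> * U t x)"
proof -
  have "\<forall>x\<in>S. \<exists>t. matrix_pow S Q t x b > 0"
    using irreducible b_in by (auto simp: irreducible_matrix_def)
  then obtain \<tau> where \<tau>: "\<And>x. x \<in> S \<Longrightarrow> matrix_pow S Q (\<tau> x) x b > 0" by metis
  define T where "T = Max (\<tau> ` S)"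
  define \<rho> where "\<rho> = Max (U T ` S)"
  have lt: "U T x < 1" if "x \<in> S" for x
  proof -
    have "\<tau> x \<le> T" using that finite_S by (simp add: T_def)
    then have "U T x \<le> U (\<tau> x) x"
      using U_decreasing[OF that, of "\<tau> x" "T - \<tau> x"] by simp
    also have "\<dots> < 1" using U_le_matrix_pow[OF that, of "\<tau> x"] \<tau>[OF that] by simp
    finally show ?thesis .
  qed
  have le: "U T x \<le> \<rho>" if "x \<in> S" for x
    using that finite_S by (simp add: \<rho>_def)
  have "\<rho> < 1"
    unfolding \<rho>_def using lt finite_S b_in by (subst Max_less_iff) auto
  moreover have "0 \<le> \<rho>" using le[OF b_in] U_nonneg[OF b_in, of T] by simp
  moreover have "U (t + T) x \<le> \<rho> * U t x" if "x \<in> S" for t x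
  proof -
    have "U T y \<le> \<rho> * U 0 y" if "y \<in> S" for y
      using le[OF that] by (cases "y = b"; cases T) (simp_all add: U_0 U_Suc killed_step_def)
    then have "(R ^^ t) (U T) x \<le> (R ^^ t) (\<lambda>y. \<rho> * U 0 y) x"
      using that by (intro R_pow_mono)
    then show ?thesis by (simp add: R_pow_mult R_pow_U)
  qed
  ultimately show ?thesis by blast
qed

text \<open>By the contraction a partial sum s satisfies s \<le> T + \<rho> s, which bounds it
  independently of its length.\<close>

lemma summable_U:
  assumes x: "x \<in> S"
  shows "summable (\<lambda>t. U t x)"
proof -
  obtain T \<rho> where \<rho>: "\<rho> < 1" "0 \<le> \<rho>" and step: "\<And>t x. x \<in> S \<Longrightarrow> U (t + T) x \<le> \<rho> * U t x"
    using U_contraction by metis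
  show ?thesis
  proof (rule summableI_nonneg_bounded)
    fix n
    have "(\<Sum>t<n. U t x) \<le> (\<Sum>t<T + n. U t x)"
      using U_nonneg[OF x] by (intro sum_mono2) auto
    also have "\<dots> = (\<Sum>t<T. U t x) + (\<Sum>t<n. U (t + T) x)"
      by (induction n) (simp_all add: add.commute)
    also have "\<dots> \<le> (\<Sum>t<T. 1) + (\<Sum>t<n. \<rho> * U t x)"
      using U_le_1[OF x] step[OF x] by (intro add_mono sum_mono)
    also have "\<dots> = real T + \<rho> * (\<Sum>t<n. U t x)"
      by (simp add: sum_distrib_left)
    finally have "(1 - \<rho>) * (\<Sum>t<n. U t x) \<le> real T" by (simp add: algebra_simps)
    then show "(\<Sum>t<n. U t x) \<le> real T / (1 - \<rho>)"
      using \<rho> by (simp add: field_simps)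
  qed (use U_nonneg[OF x] in auto)
qed

text \<open>Since \<open>w\<close> vanishes at \<open>b\<close>, its absolute value is at most a
  multiple of \<open>U 0\<close>; positivity of \<open>R\<close> propagates the bound.\<close>

lemma abs_R_pow_le:
  assumes "w b = 0" and "x \<in> S"
  shows "\<bar>(R ^^ t) w x\<bar> \<le> Max ((\<lambda>y. \<bar>w y\<bar>) ` S) * U t x"
proof -
  let ?C = "Max ((\<lambda>y. \<bar>w y\<bar>) ` S)"
  have C: "\<bar>w y\<bar> \<le> ?C * U 0 y" if "y \<in> S" for y
    using that finite_S assms(1) by (cases "y = b") (simp_all add: U_0)
  have "(R ^^ t) w x \<le> (R ^^ t) (\<lambda>y. ?C * U 0 y) x"
    using C assms(2) by (intro R_pow_mono) (auto simp: abs_le_iff)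
  moreover have "(R ^^ t) (\<lambda>y. - 1 * w y) x \<le> (R ^^ t) (\<lambda>y. ?C * U 0 y) x"
    using C assms(2) by (intro R_pow_mono) (auto simp: abs_le_iff)
  ultimately show ?thesis
    unfolding R_pow_mult by (simp add: R_pow_U)
qed

lemma summable_R_pow:
  assumes "w b = 0" and "x \<in> S"
  shows "summable (\<lambda>t. (R ^^ t) w x)"
proof (rule summable_comparison_test')
  show "summable (\<lambda>t. Max ((\<lambda>y. \<bar>w y\<bar>) ` S) * U t x)"
    using summable_mult[OF summable_U[OF assms(2)]] .
  show "norm ((R ^^ t) w x) \<le> Max ((\<lambda>y. \<bar>w y\<bar>) ` S) * U t x" if "0 \<le> t" for t
    using abs_R_pow_le[of w x t] assms by simp
qed

lemma R_pow_at_b: "w b = 0 \<Longrightarrow> (R ^^ t) w b = 0"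
  by (cases t) (simp_all add: killed_step_def)

lemma potential_at_b: "w b = 0 \<Longrightarrow> G w b = 0"
  by (simp add: potential_def R_pow_at_b)

lemma potential_eq:
  assumes "w b = 0" and "x \<in> S"
  shows "G w x = w x + R (G w) x"
proof (cases "x = b")
  case True
  then show ?thesis using assms potential_at_b by (simp add: killed_step_def)
next
  case False
  have "(\<Sum>t. (R ^^ Suc t) w x) = (\<Sum>t. \<Sum>c\<in>S. Q x c * (R ^^ t) w c)"
    using False by (simp add: killed_step_def)
  also have "\<dots> = (\<Sum>c\<in>S. \<Sum>t. Q x c * (R ^^ t) w c)"
    using assms(1) by (intro suminf_sum summable_mult summable_R_pow)
  also have "\<dots> = (\<Sum>c\<in>S. Q x c * G w c)"
    unfolding potential_def using assms(1) by (intro sum.cong suminf_mult summable_R_pow) auto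
  finally show ?thesis
    using suminf_split_head[OF summable_R_pow[of w x]] assms False
    by (simp add: potential_def killed_step_def)
qed

lemma R_pow_nonneg:
  assumes "\<And>x. x \<in> S \<Longrightarrow> 0 \<le> w x" "x \<in> S"
  shows "0 \<le> (R ^^ t) w x"
  using R_pow_mono[of "\<lambda>_. 0 * 0" w x t] assms unfolding R_pow_mult by simp

lemma potential_nonneg:
  assumes "w b = 0" "\<And>x. x \<in> S \<Longrightarrow> 0 \<le> w x" "x \<in> S"
  shows "0 \<le> G w x"
  unfolding potential_def using assms by (intro suminf_nonneg summable_R_pow R_pow_nonneg)

text \<open>Such a function is fixed by \<open>R\<close>, whose powers tend to zero on it. This is
  the source of uniqueness for the linear systems.\<close>

lemma harmonic_zero:
  assumes "z b = 0" and z: "\<And>x. x \<in> S \<Longrightarrow> x \<noteq> b \<Longrightarrow> z x = (\<Sum>c\<in>S. Q x c * z c)" and "x \<in> S"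
  shows "z x = 0"
proof -
  have fixpoint: "(R ^^ t) z y = z y" if "y \<in> S" for t y
    using that
  proof (induction t arbitrary: y)
    case (Suc t)
    then show ?case using assms(1) z[of y] by (simp add: killed_step_def)
  qed simp
  have "(\<lambda>t. (R ^^ t) z x) \<longlonglongrightarrow> 0"
    using summable_LIMSEQ_zero[OF summable_R_pow[of z x]] assms by simp
  then show ?thesis
    using fixpoint[OF assms(3)] by (simp add: LIMSEQ_const_iff)
qed

lemma H_at_b: "H b = 0" and K_at_b: "K b = 0"
  by (simp_all add: hit_mean_def hit_second_def potential_at_b)

lemma H_eq: "x \<in> S \<Longrightarrow> H x = of_bool (x \<noteq> b) + R H x"
  using potential_eq[of "\<lambda>x. of_bool (x \<noteq> b)" x] by (simp add: hit_mean_def)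

lemma K_eq: "x \<in> S \<Longrightarrow> K x = H x + R K x"
  using potential_eq[of H x] H_at_b by (simp add: hit_second_def)

lemma H_nonneg: "x \<in> S \<Longrightarrow> 0 \<le> H x"
  using potential_nonneg[of "\<lambda>x. of_bool (x \<noteq> b)" x] by (simp add: hit_mean_def)

lemma K_nonneg: "x \<in> S \<Longrightarrow> 0 \<le> K x"
  using potential_nonneg[of H x] H_at_b H_nonneg by (simp add: hit_second_def)

lemma survival_sums: "x \<in> S \<Longrightarrow> (\<lambda>t. U t x) sums H x"
  using summable_sums[OF summable_U, of x]
  by (simp add: hit_mean_def potential_def survival_def)

text \<open>In the double series for \<open>K\<close> the term \<open>U t\<close> occurs
  \<open>t + 1\<close> times. Instead of a rearrangement, summation by parts is used with the tails
  \<open>d t\<close> and \<open>e t\<close> of the series for \<open>H\<close> and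
  \<open>K\<close>.\<close>

lemma survival_weighted_sums:
  assumes x: "x \<in> S"
  shows "(\<lambda>t. real (Suc t) * U t x) sums K x"
proof -
  define d where "d t = (R ^^ t) H x" for t
  define e where "e t = (R ^^ t) K x" for t
  have d: "d t = U t x + d (Suc t)" for t
    using R_pow_cong[of H "\<lambda>y. of_bool (y \<noteq> b) + R H y" x t] H_eq x
      R_pow_add[of t "\<lambda>y. of_bool (y \<noteq> b)" "R H" x]
    by (simp add: d_def survival_def funpow_swap1)
  have e: "e t = d t + e (Suc t)" for t
    using R_pow_cong[of K "\<lambda>y. H y + R K y" x t] K_eq x R_pow_add[of t H "R K" x]
    by (simp add: d_def e_def funpow_swap1)
  have d_nonneg: "0 \<le> d t" and e_nonneg: "0 \<le> e t" for t
    unfolding d_def e_def using H_nonneg K_nonneg x by (auto intro: R_pow_nonneg)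
  have partial: "(\<Sum>t<n. real (Suc t) * U t x) = K x - e n - real n * d n" for n
  proof (induction n)
    case 0
    then show ?case by (simp add: e_def)
  next
    case (Suc n)
    have u: "U n x = d n - d (Suc n)" using d[of n] by simp
    show ?case unfolding sum.lessThan_Suc Suc u using e[of n] by (simp add: algebra_simps)
  qed
  have "summable (\<lambda>t. real (Suc t) * U t x)"
  proof (rule summableI_nonneg_bounded)
    show "(\<Sum>t<n. real (Suc t) * U t x) \<le> K x" for n
      unfolding partial using e_nonneg[of n] mult_nonneg_nonneg[OF of_nat_0_le_iff d_nonneg, of n n] by simp
  qed (use U_nonneg[OF x] in auto)
  then have lim: "(\<lambda>t. real (Suc t) * U t x) \<longlonglongrightarrow> 0" by (rule summable_LIMSEQ_zero)
  \<comment> \<open>Convergence of the weighted series already gives that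
    \<open>(n + 1) * U n\<close> tends to 0, and \<open>d n\<close> is at most a constant times
    \<open>U n\<close> because \<open>H\<close> vanishes at \<open>b\<close>.\<close>
  have "(\<lambda>n. real n * d n) \<longlonglongrightarrow> 0"
  proof (rule tendsto_sandwich[OF _ _ tendsto_const])
    let ?C = "Max ((\<lambda>y. \<bar>H y\<bar>) ` S)"
    have "\<bar>H b\<bar> \<le> ?C" using finite_S b_in by (intro Max_ge) auto
    then have C: "0 \<le> ?C" by linarith
    have "real n * d n \<le> ?C * (real (Suc n) * U n x)" for n
    proof -
      have "d n \<le> ?C * U n x"
        using abs_R_pow_le[of H x n] H_at_b x by (simp add: d_def)
      then have "real n * d n \<le> real (Suc n) * (?C * U n x)"
        using d_nonneg[of n] by (intro mult_mono) auto
      then show ?thesis by (simp add: algebra_simps)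
    qed
    then show "\<forall>\<^sub>F n in sequentially. real n * d n \<le> ?C * (real (Suc n) * U n x)" by simp
    show "(\<lambda>n. ?C * (real (Suc n) * U n x)) \<longlonglongrightarrow> 0"
      using tendsto_mult_right_zero[OF lim] by simp
  qed (use d_nonneg in auto)
  moreover have "e \<longlonglongrightarrow> 0"
    unfolding e_def using summable_LIMSEQ_zero[OF summable_R_pow[of K x]] K_at_b x by simp
  ultimately have "(\<lambda>n. K x - e n - real n * d n) \<longlonglongrightarrow> K x - 0 - 0"
    by (intro tendsto_diff tendsto_const)
  then show ?thesis unfolding sums_def partial by simp
qed

end

section \<open>The law of the hitting time of a Markov chain\<close>

lemma markov_chain_pred:
  assumes "markov_chain_from S Q a M X" "finite S"
  shows "Measurable.pred M (\<lambda>\<omega>. X t \<omega> = v)"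
proof -
  have "X t \<in> measurable M (count_space S)"
    using assms by (auto simp: markov_chain_from_def)
  then have "X t -` ({v} \<inter> S) \<inter> space M \<in> sets M"
    by (rule measurable_sets) simp
  moreover have "X t -` ({v} \<inter> S) \<inter> space M = {\<omega> \<in> space M. X t \<omega> = v}"
    using measurable_space[OF \<open>X t \<in> measurable M (count_space S)\<close>] by auto
  ultimately show ?thesis by (simp add: pred_def)
qed

lemma markov_chain_state:
  assumes "markov_chain_from S Q a M X" "\<omega> \<in> space M"
  shows "X t \<omega> \<in> S"
  using assms measurable_space[of "X t" M "count_space S"] by (auto simp: markov_chain_from_def)

text \<open>The Markov property says nothing about histories of probability zero; for these both
  sides vanish.\<close>

lemma markov_chain_path_step:
  assumes chain: "markov_chain_from S Q a M X" and "finite S" and y: "y \<in> S"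
  shows "\<P>(\<omega> in M. (\<forall>s\<le>t. X s \<omega> = p s) \<and> X (Suc t) \<omega> = y) =
         \<P>(\<omega> in M. \<forall>s\<le>t. X s \<omega> = p s) * Q (p t) y"
proof -
  interpret prob_space M using chain by (simp add: markov_chain_from_def)
  note [measurable] = markov_chain_pred[OF chain \<open>finite S\<close>]
  show ?thesis
  proof (cases "\<P>(\<omega> in M. \<forall>s\<le>t. X s \<omega> = p s) > 0")
    case True
    then have "\<P>(\<omega> in M. X (Suc t) \<omega> = y \<bar> \<forall>s\<le>t. X s \<omega> = p s) = Q (p t) y"
      using chain y by (simp add: markov_chain_from_def)
    then show ?thesis
      using True by (simp add: cond_prob_def field_simps conj_commute)
  next
    case False
    have "\<P>(\<omega> in M. (\<forall>s\<le>t. X s \<omega> = p s) \<and> X (Suc t) \<omega> = y) \<le> \<P>(\<omega> in M. \<forall>s\<le>t. X s \<omega> = p s)"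
      by (intro finite_measure_mono) auto
    then show ?thesis
      using False by (simp add: not_less measure_le_0_iff)
  qed
qed

text \<open>The Markov property is only assumed given the complete past; the event on the left is the
  disjoint union of the events prescribing a path that avoids \<open>b\<close> and ends in \<open>c\<close>.\<close>

lemma markov_chain_avoid_step:
  assumes chain: "markov_chain_from S Q a M X" and S: "finite S" and c: "c \<in> S" and y: "y \<in> S"
  shows "\<P>(\<omega> in M. (\<forall>s\<le>t. X s \<omega> \<noteq> b) \<and> X t \<omega> = c \<and> X (Suc t) \<omega> = y) =
         \<P>(\<omega> in M. (\<forall>s\<le>t. X s \<omega> \<noteq> b) \<and> X t \<omega> = c) * Q c y"
proof -
  interpret prob_space M using chain by (simp add: markov_chain_from_def)
  note [measurable] = markov_chain_pred[OF chain S]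
  \<comment> \<open>Histories are extensional functions on \<open>{..t}\<close>, so there are
    finitely many and their events are disjoint.\<close>
  define I where "I = {p \<in> {..t} \<rightarrow>\<^sub>E S. (\<forall>s\<le>t. p s \<noteq> b) \<and> p t = c}"
  have I: "finite I" 
    by (rule finite_subset[of _ "{..t} \<rightarrow>\<^sub>E S"]) (auto simp: I_def intro: finite_PiE S)
  \<comment> \<open>The extra event \<open>B\<close> is instantiated by the next step and by
    \<open>True\<close>, one for each side of the claim.\<close>
  have path: "\<P>(\<omega> in M. (\<forall>s\<le>t. X s \<omega> \<noteq> b) \<and> X t \<omega> = c \<and> B \<omega>) =
      (\<Sum>p\<in>I. \<P>(\<omega> in M. (\<forall>s\<le>t. X s \<omega> = p s) \<and> B \<omega>))"
    if [measurable]: "Measurable.pred M B" for B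
  proof -
    define E where "E p = {\<omega> \<in> space M. (\<forall>s\<le>t. X s \<omega> = p s) \<and> B \<omega>}" for p
    have "disjoint_family_on E I"
    proof (unfold disjoint_family_on_def, intro ballI impI)
      fix p q assume pq: "p \<in> I" "q \<in> I" "p \<noteq> q"
      have "p = q" if "\<omega> \<in> E p" "\<omega> \<in> E q" for \<omega>
      proof (rule PiE_ext)
        show "p \<in> {..t} \<rightarrow>\<^sub>E S" "q \<in> {..t} \<rightarrow>\<^sub>E S" using pq by (auto simp: I_def)
        show "p s = q s" if "s \<in> {..t}" for s
          using \<open>\<omega> \<in> E p\<close> \<open>\<omega> \<in> E q\<close> that unfolding E_def
          by (metis (mono_tags, lifting) atMost_iff mem_Collect_eq)
      qed
      then show "E p \<inter> E q = {}" using pq by blast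
    qed
    moreover have "E ` I \<subseteq> sets M" unfolding E_def by auto
    ultimately have "measure M (\<Union>p\<in>I. E p) = (\<Sum>p\<in>I. measure M (E p))"
      using I by (intro finite_measure_finite_Union)
    moreover have "(\<Union>p\<in>I. E p) = {\<omega> \<in> space M. (\<forall>s\<le>t. X s \<omega> \<noteq> b) \<and> X t \<omega> = c \<and> B \<omega>}"
    proof (intro equalityI subsetI)
      fix \<omega> assume "\<omega> \<in> (\<Union>p\<in>I. E p)"
      then show "\<omega> \<in> {\<omega> \<in> space M. (\<forall>s\<le>t. X s \<omega> \<noteq> b) \<and> X t \<omega> = c \<and> B \<omega>}"
        unfolding I_def E_def by auto
    next
      fix \<omega> assume \<omega>: "\<omega> \<in> {\<omega> \<in> space M. (\<forall>s\<le>t. X s \<omega> \<noteq> b) \<and> X t \<omega> = c \<and> B \<omega>}"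
      have "restrict (\<lambda>s. X s \<omega>) {..t} \<in> I"
        using \<omega> markov_chain_state[OF chain] by (auto simp: I_def)
      moreover have "\<omega> \<in> E (restrict (\<lambda>s. X s \<omega>) {..t})"
        using \<omega> by (auto simp: E_def)
      ultimately show "\<omega> \<in> (\<Union>p\<in>I. E p)" by blast
    qed
    ultimately show ?thesis by (simp add: E_def)
  qed
  have "\<P>(\<omega> in M. (\<forall>s\<le>t. X s \<omega> \<noteq> b) \<and> X t \<omega> = c \<and> X (Suc t) \<omega> = y) =
      (\<Sum>p\<in>I. \<P>(\<omega> in M. \<forall>s\<le>t. X s \<omega> = p s) * Q (p t) y)"
    by (subst path) (simp_all add: markov_chain_path_step[OF chain S y])
  also have "\<dots> = (\<Sum>p\<in>I. \<P>(\<omega> in M. (\<forall>s\<le>t. X s \<omega> = p s) \<and> True)) * Q c y"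
    unfolding sum_distrib_right by (intro sum.cong) (auto simp: I_def)
  also have "\<dots> = \<P>(\<omega> in M. (\<forall>s\<le>t. X s \<omega> \<noteq> b) \<and> X t \<omega> = c \<and> True) * Q c y"
    by (subst path) simp_all
  finally show ?thesis by simp
qed

text \<open>The mass \<open>m t\<close> of the paths that have avoided \<open>b\<close> evolves
  forward with the chain, whereas \<open>survival\<close> evolves functions of the initial state.
  The fact \<open>pair\<close> is the duality between the two; it is stated for all functions
  vanishing at \<open>b\<close> because its induction applies it to
  \<open>killed_step S Q b w\<close>.\<close>

lemma markov_chain_avoid_prob:
  assumes chain: "markov_chain_from S Q a M X" and S: "finite S" and a: "a \<in> S"
  shows "\<P>(\<omega> in M. \<forall>s\<le>t. X s \<omega> \<noteq> b) = survival S Q b t a"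
proof -
  interpret prob_space M using chain by (simp add: markov_chain_from_def)
  note [measurable] = markov_chain_pred[OF chain S]
  define m where "m t c = \<P>(\<omega> in M. (\<forall>s\<le>t. X s \<omega> \<noteq> b) \<and> X t \<omega> = c)" for t c
  have split: "(\<Sum>c\<in>S. \<P>(\<omega> in M. B \<omega> \<and> X t \<omega> = c)) = \<P>(\<omega> in M. B \<omega>)"
    if [measurable]: "Measurable.pred M B" for B t
  proof -
    have "measure M (\<Union>c\<in>S. {\<omega> \<in> space M. B \<omega> \<and> X t \<omega> = c}) =
        (\<Sum>c\<in>S. \<P>(\<omega> in M. B \<omega> \<and> X t \<omega> = c))"
      using S by (intro finite_measure_finite_Union) (auto simp: disjoint_family_on_def)
    moreover have "(\<Union>c\<in>S. {\<omega> \<in> space M. B \<omega> \<and> X t \<omega> = c}) = {\<omega> \<in> space M. B \<omega>}"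
      using markov_chain_state[OF chain] by auto
    ultimately show ?thesis by simp
  qed
  have m_0: "m 0 c = of_bool (c = a \<and> a \<noteq> b)" for c
  proof -
    have "AE \<omega> in M. X 0 \<omega> = a" using chain by (simp add: markov_chain_from_def)
    then have "m 0 c = \<P>(\<omega> in M. a = c \<and> a \<noteq> b)"
      unfolding m_def by (intro finite_measure_eq_AE) auto
    then show ?thesis by (auto simp: prob_space)
  qed
  have m_at_b: "m t b = 0" for t
  proof -
    have empty: "{\<omega> \<in> space M. (\<forall>s\<le>t. X s \<omega> \<noteq> b) \<and> X t \<omega> = b} = {}" by auto
    show ?thesis unfolding m_def empty by simp
  qed
  have m_Suc: "m (Suc t) y = (if y = b then 0 else \<Sum>c\<in>S. m t c * Q c y)" if "y \<in> S" for t y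
  proof (cases "y = b")
    case True
    then have empty: "{\<omega> \<in> space M. (\<forall>s\<le>Suc t. X s \<omega> \<noteq> b) \<and> X (Suc t) \<omega> = y} = {}" by auto
    show ?thesis unfolding m_def empty using True by simp
  next
    case False
    have "m (Suc t) y = \<P>(\<omega> in M. (\<forall>s\<le>t. X s \<omega> \<noteq> b) \<and> X (Suc t) \<omega> = y)"
      unfolding m_def using False by (intro arg_cong[of _ _ "measure M"]) (auto simp: le_Suc_eq)
    also have "\<dots> = (\<Sum>c\<in>S. \<P>(\<omega> in M. ((\<forall>s\<le>t. X s \<omega> \<noteq> b) \<and> X (Suc t) \<omega> = y) \<and> X t \<omega> = c))"
      by (subst split) simp_all
    also have "\<dots> = (\<Sum>c\<in>S. m t c * Q c y)"
      unfolding m_def using markov_chain_avoid_step[OF chain S _ that, of _ t b]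
      by (intro sum.cong refl) (simp add: conj_ac)
    finally show ?thesis using False by simp
  qed
  have pair: "(\<Sum>c\<in>S. m t c * w c) = (killed_step S Q b ^^ t) w a" if "w b = 0" for t w
    using that
  proof (induction t arbitrary: w)
    case 0
    have "(\<Sum>c\<in>S. m 0 c * w c) = (\<Sum>c\<in>S. if c = a then w a else 0)"
      using 0 by (intro sum.cong) (auto simp: m_0)
    then show ?case using S a by simp
  next
    case (Suc t)
    have "(\<Sum>y\<in>S. m (Suc t) y * w y) = (\<Sum>y\<in>S. \<Sum>c\<in>S. m t c * (Q c y * w y))"
      using Suc.prems by (intro sum.cong) (auto simp: m_Suc sum_distrib_right mult.assoc)
    also have "\<dots> = (\<Sum>c\<in>S. m t c * (\<Sum>y\<in>S. Q c y * w y))"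
      by (subst sum.swap) (simp add: sum_distrib_left)
    also have "\<dots> = (\<Sum>c\<in>S. m t c * killed_step S Q b w c)"
    proof (intro sum.cong refl)
      fix c
      show "m t c * (\<Sum>y\<in>S. Q c y * w y) = m t c * killed_step S Q b w c"
        using m_at_b[of t] by (auto simp: killed_step_def)
    qed
    also have "\<dots> = (killed_step S Q b ^^ t) (killed_step S Q b w) a"
      by (intro Suc.IH) (simp add: killed_step_def)
    finally show ?case by (simp add: funpow_swap1)
  qed
  have "\<P>(\<omega> in M. \<forall>s\<le>t. X s \<omega> \<noteq> b) = (\<Sum>c\<in>S. m t c)"
    unfolding m_def by (subst split) simp_all
  also have "\<dots> = (\<Sum>c\<in>S. m t c * of_bool (c \<noteq> b))"
  proof (intro sum.cong refl)
    fix c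
    show "m t c = m t c * of_bool (c \<noteq> b)" using m_at_b[of t] by auto
  qed
  also have "\<dots> = survival S Q b t a"
    unfolding survival_def by (rule pair) simp
  finally show ?thesis .
qed

lemma hitting_time_has_variance:
  assumes chain: "markov_chain_from S Q a M X" and S: "finite S" and a: "a \<in> S" and b: "b \<in> S"
    and "stochastic_matrix S Q" and "irreducible_matrix S Q"
  shows "has_variance M (hitting_time X b)
           (2 * hit_second S Q b a - hit_mean S Q b a - (hit_mean S Q b a)\<^sup>2)"
proof -
  interpret prob_space M using chain by (simp add: markov_chain_from_def)
  interpret killed_chain S Q b using assms by unfold_locales
  note [measurable] = markov_chain_pred[OF chain S]
  \<comment> \<open>Where \<open>b\<close> is never hit, \<open>the_enat\<close> of infinity is an
    unspecified number. Those outcomes form a null set, so \<open>D\<close> is tied to the path only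
    almost everywhere.\<close>
  define D where "D \<omega> = the_enat (hitting_time X b \<omega>)" for \<omega>
  have D_eq: "D = (\<lambda>\<omega>. if \<exists>t. X t \<omega> = b then LEAST t. X t \<omega> = b else the_enat \<infinity>)"
    by (auto simp: D_def hitting_time_def)
  have [measurable]: "D \<in> measurable M (count_space UNIV)"
    unfolding D_eq by measurable
  have prob_U: "\<P>(\<omega> in M. \<forall>s\<le>t. X s \<omega> \<noteq> b) = U t a" for t
    using markov_chain_avoid_prob[OF chain S a] .
  have hit: "AE \<omega> in M. \<exists>t. X t \<omega> = b"
  proof -
    have "prob {\<omega> \<in> space M. \<not> (\<exists>t. X t \<omega> = b)} \<le> U t a" for t
      unfolding prob_U[symmetric] by (intro finite_measure_mono) auto
    moreover have "(\<lambda>t. U t a) \<longlonglongrightarrow> 0"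
      using summable_LIMSEQ_zero[OF summable_U[OF a]] .
    ultimately have "prob {\<omega> \<in> space M. \<not> (\<exists>t. X t \<omega> = b)} \<le> 0"
      by (intro LIMSEQ_le_const) auto
    then have "prob {\<omega> \<in> space M. \<not> (\<exists>t. X t \<omega> = b)} = 0"
      by (simp add: measure_le_0_iff)
    then show ?thesis by (subst AE_iff_measurable[OF _ refl]) (auto simp: emeasure_eq_measure)
  qed
  have D_gt: "AE \<omega> in M. (t < D \<omega>) = (\<forall>s\<le>t. X s \<omega> \<noteq> b)" for t
    using hit
  proof eventually_elim
    case (elim \<omega>)
    then have D: "D \<omega> = (LEAST t. X t \<omega> = b)" by (simp add: D_eq)
    have at: "X (D \<omega>) \<omega> = b" unfolding D using elim by (rule LeastI_ex)
    have before: "X s \<omega> \<noteq> b" if "s < D \<omega>" for s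
      using not_less_Least[of s "\<lambda>t. X t \<omega> = b"] that by (simp add: D)
    show ?case
    proof
      assume "t < D \<omega>"
      show "\<forall>s\<le>t. X s \<omega> \<noteq> b"
      proof (intro allI impI)
        fix s assume "s \<le> t"
        then have "s < D \<omega>" using \<open>t < D \<omega>\<close> by (rule le_less_trans)
        then show "X s \<omega> \<noteq> b" by (rule before)
      qed
    next
      assume avoid: "\<forall>s\<le>t. X s \<omega> \<noteq> b"
      show "t < D \<omega>"
      proof (rule ccontr)
        assume "\<not> t < D \<omega>"
        then have "X (D \<omega>) \<omega> \<noteq> b" using avoid by simp
        then show False using at by contradiction
      qed
    qed
  qed
  have prob_D: "\<P>(\<omega> in M. t < D \<omega>) = U t a" for t
    unfolding prob_U[symmetric] using D_gt[of t] by (intro finite_measure_eq_AE) auto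
  \<comment> \<open>Tail sum formula, used below with weights 1 and \<open>2 t + 1\<close>, which
    produce \<open>D\<close> and its square. The passage through the nonnegative integral yields
    integrability together with the value.\<close>
  have moment: "has_bochner_integral M (\<lambda>\<omega>. \<Sum>t<D \<omega>. c t) v"
    if c: "\<And>t. 0 \<le> c t" and sums: "(\<lambda>t. c t * U t a) sums v" for c :: "nat \<Rightarrow> real" and v
  proof (rule has_bochner_integral_nn_integral)
    show "(\<lambda>\<omega>. \<Sum>t<D \<omega>. c t) \<in> borel_measurable M"
      by (rule measurable_compose[of D M "count_space UNIV" "\<lambda>k. \<Sum>t<k. c t"]) simp_all
    have term_nonneg: "0 \<le> c t * U t a" for t using c U_nonneg[OF a] by simp
    show "0 \<le> v" using sums_le[OF _ sums_zero sums] term_nonneg by simp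
    show "AE \<omega> in M. 0 \<le> (\<Sum>t<D \<omega>. c t)" using c by (simp add: sum_nonneg)
    have "ennreal (\<Sum>t<D \<omega>. c t) = (\<Sum>t. ennreal (c t) * indicator {\<omega>. t < D \<omega>} \<omega>)" for \<omega>
    proof -
      have "(\<Sum>t. ennreal (c t) * indicator {\<omega>. t < D \<omega>} \<omega>) =
          (\<Sum>t<D \<omega>. ennreal (c t) * indicator {\<omega>. t < D \<omega>} \<omega>)"
        by (rule suminf_finite) auto
      also have "\<dots> = (\<Sum>t<D \<omega>. ennreal (c t))" by (intro sum.cong) auto
      also have "\<dots> = ennreal (\<Sum>t<D \<omega>. c t)" using c by (simp add: sum_ennreal)
      finally show ?thesis ..
    qed
    then have "(\<integral>\<^sup>+\<omega>. ennreal (\<Sum>t<D \<omega>. c t) \<partial>M) =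
        (\<integral>\<^sup>+\<omega>. (\<Sum>t. ennreal (c t) * indicator {\<omega>. t < D \<omega>} \<omega>) \<partial>M)" by simp
    also have "\<dots> = (\<Sum>t. \<integral>\<^sup>+\<omega>. ennreal (c t) * indicator {\<omega>. t < D \<omega>} \<omega> \<partial>M)"
      by (intro nn_integral_suminf) measurable
    also have "\<dots> = (\<Sum>t. ennreal (c t * U t a))"
    proof (intro suminf_cong)
      fix t
      have "(\<integral>\<^sup>+\<omega>. ennreal (c t) * indicator {\<omega>. t < D \<omega>} \<omega> \<partial>M) =
          (\<integral>\<^sup>+\<omega>. ennreal (c t) * indicator {\<omega> \<in> space M. t < D \<omega>} \<omega> \<partial>M)"
        by (intro nn_integral_cong) (auto split: split_indicator)
      also have "\<dots> = ennreal (c t) * emeasure M {\<omega> \<in> space M. t < D \<omega>}"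
        by (intro nn_integral_cmult_indicator) measurable
      also have "\<dots> = ennreal (c t * U t a)"
        using c by (simp add: emeasure_eq_measure prob_D ennreal_mult')
      finally show "(\<integral>\<^sup>+\<omega>. ennreal (c t) * indicator {\<omega>. t < D \<omega>} \<omega> \<partial>M) = ennreal (c t * U t a)" .
    qed
    also have "\<dots> = ennreal v"
      using suminf_ennreal_eq[OF term_nonneg sums] .
    finally show "(\<integral>\<^sup>+\<omega>. ennreal (\<Sum>t<D \<omega>. c t) \<partial>M) = ennreal v" .
  qed
  have first: "has_bochner_integral M (\<lambda>\<omega>. real (D \<omega>)) (H a)"
    using moment[of "\<lambda>_. 1" "H a"] survival_sums[OF a] by simp
  have square: "(\<Sum>t<k. 2 * real (Suc t) - 1) = (real k)\<^sup>2" for k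
    by (induction k) (simp_all add: power2_eq_square algebra_simps)
  have "(\<lambda>t. 2 * (real (Suc t) * U t a) - U t a) sums (2 * K a - H a)"
    by (intro sums_diff sums_mult survival_sums survival_weighted_sums a)
  then have "(\<lambda>t. (2 * real (Suc t) - 1) * U t a) sums (2 * K a - H a)"
    by (simp only: left_diff_distrib mult.assoc mult_1)
  then have second: "has_bochner_integral M (\<lambda>\<omega>. (real (D \<omega>))\<^sup>2) (2 * K a - H a)"
    using moment[of "\<lambda>t. 2 * real (Suc t) - 1"] unfolding square by simp
  have "variance (\<lambda>\<omega>. real (D \<omega>)) = 2 * K a - H a - (H a)\<^sup>2"
    using first second by (subst variance_eq) (auto simp: has_bochner_integral_iff)
  moreover have "AE \<omega> in M. hitting_time X b \<omega> \<noteq> \<infinity>"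
    using hit by eventually_elim (simp add: hitting_time_def)
  ultimately show ?thesis
    using second unfolding has_variance_def D_def by (simp add: has_bochner_integral_iff)
qed


section \<open>Orbits of FI-sets\<close>

declare One_nat_def [simp del]

lemma eventually_monotone_predicate:
  fixes N :: nat
  assumes "\<And>n. n \<ge> N \<Longrightarrow> P n \<Longrightarrow> P (Suc n)"
  shows "(\<forall>\<^sub>F n in sequentially. P n) \<or> (\<forall>\<^sub>F n in sequentially. \<not> P n)"
proof (cases "\<exists>m\<ge>N. P m")
  case True
  then obtain m where m: "m \<ge> N" "P m" by blast
  have "P n" if "n \<ge> m" for n
    using that
  proof (induction n rule: dec_induct)
    case (step n)
    then show ?case using assms[of n] m(1) by simp
  qed (rule m(2))
  then show ?thesis unfolding eventually_sequentially by blast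
next
  case False
  then show ?thesis unfolding eventually_sequentially by blast
qed

lemma eventually_constant_if_decreasing:
  fixes f :: "nat \<Rightarrow> nat"
  assumes "\<And>n. n \<ge> N \<Longrightarrow> f (Suc n) \<le> f n"
  obtains c where "\<forall>\<^sub>F n in sequentially. f n = c"
proof -
  define c where "c = (LEAST v. \<exists>n\<ge>N. f n = v)"
  have "\<exists>n\<ge>N. f n = c" unfolding c_def by (rule LeastI[of _ "f N"]) auto
  then obtain m where m: "m \<ge> N" "f m = c" by blast
  have "f n = c" if "n \<ge> m" for n
  proof (rule antisym)
    show "f n \<le> c" using that
    proof (induction n rule: dec_induct)
      case (step n)
      then show ?case using assms[of n] m by simp
    qed (simp add: m)
    show "c \<le> f n" unfolding c_def using that m by (intro Least_le exI[of _ n]) auto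
  qed
  then have "\<forall>\<^sub>F n in sequentially. f n = c" unfolding eventually_sequentially by blast
  then show ?thesis by (rule that)
qed

text \<open>The complements of \<open>A\<close> and of its image in \<open>S\<close> have the same
  size, so a bijection between them completes \<open>f\<close>.\<close>

lemma inj_on_extends_to_permutation:
  assumes "finite S" "A \<subseteq> S" "inj_on f A" "f ` A \<subseteq> S"
  shows "\<exists>p. p permutes S \<and> (\<forall>i\<in>A. p i = f i)"
proof -
  have "card (S - A) = card (S - f ` A)"
    using assms by (simp add: card_Diff_subset card_image finite_subset)
  then obtain g where g: "bij_betw g (S - A) (S - f ` A)"
    using assms(1) by (meson finite_Diff finite_same_card_bij)
  define p where "p i = (if i \<in> A then f i else if i \<in> S then g i else i)" for i
  have "bij_betw p A (f ` A)"
    using assms(3) by (auto simp: bij_betw_def p_def inj_on_def)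
  moreover have "bij_betw p (S - A) (S - f ` A)"
    using g by (rule bij_betw_cong[THEN iffD2, rotated]) (auto simp: p_def)
  ultimately have "bij_betw p (A \<union> (S - A)) (f ` A \<union> (S - f ` A))"
    by (intro bij_betw_combine) auto
  then have "bij_betw p S S" using assms by (simp add: Un_absorb1)
  then have "p permutes S"
    by (rule bij_imp_permutes) (use assms(2) in \<open>auto simp: p_def\<close>)
  moreover have "\<forall>i\<in>A. p i = f i" by (simp add: p_def)
  ultimately show ?thesis by blast
qed

section \<open>The action of injections and the orbits it generates\<close>

definition FI_emb :: "nat \<Rightarrow> nat \<Rightarrow> (nat \<Rightarrow> nat) \<Rightarrow> bool" where
  "FI_emb m n f \<longleftrightarrow> inj_on f {1..m} \<and> f ` {1..m} \<subseteq> {1..n}"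

text \<open>Unlike \<open>FI_map\<close>, this takes maps that need not be extensional, in particular permutations of
  \<open>nat\<close>, so that functoriality holds for ordinary composition.\<close>

definition FI_act :: "'a FI_data \<Rightarrow> nat \<Rightarrow> nat \<Rightarrow> (nat \<Rightarrow> nat) \<Rightarrow> 'a \<Rightarrow> 'a" where
  "FI_act Z m n f = FI_map Z m n (restrict f {1..m})"

lemma FI_emb_restrict: "FI_emb m n f \<Longrightarrow> restrict f {1..m} \<in> FI_hom m n"
  by (simp add: FI_emb_def FI_hom_def restrict_PiE_iff image_subset_iff)

lemma FI_hom_emb: "f \<in> FI_hom m n \<Longrightarrow> FI_emb m n f"
  using PiE_mem[of f "{1..m}" "\<lambda>_. {1..n}"]
  by (simp add: FI_emb_def FI_hom_def image_subset_iff del: atLeastAtMost_iff)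

lemma FI_map_eq_act: "f \<in> FI_hom m n \<Longrightarrow> FI_map Z m n f = FI_act Z m n f"
proof -
  assume "f \<in> FI_hom m n"
  then have "restrict f {1..m} = f" unfolding FI_hom_def by (intro PiE_restrict) blast
  then show ?thesis by (simp only: FI_act_def)
qed

lemma FI_hom_image: "(\<lambda>f. FI_map Z m n f x) ` FI_hom m n = {FI_act Z m n f x | f. FI_emb m n f}"
proof (intro equalityI subsetI)
  fix y assume "y \<in> (\<lambda>f. FI_map Z m n f x) ` FI_hom m n"
  then obtain f where "f \<in> FI_hom m n" "y = FI_map Z m n f x" by blast
  then show "y \<in> {FI_act Z m n f x | f. FI_emb m n f}"
    by (intro CollectI exI[of _ f]) (simp add: FI_hom_emb FI_map_eq_act)
next
  fix y assume "y \<in> {FI_act Z m n f x | f. FI_emb m n f}"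
  then obtain f where "FI_emb m n f" "y = FI_act Z m n f x" by blast
  then show "y \<in> (\<lambda>f. FI_map Z m n f x) ` FI_hom m n"
    by (intro image_eqI[of _ _ "restrict f {1..m}"]) (simp_all add: FI_act_def FI_emb_restrict)
qed

lemma FI_emb_id: "m \<le> n \<Longrightarrow> FI_emb m n id"
  by (simp add: FI_emb_def)

lemma FI_emb_permutes: "p permutes {1..n} \<Longrightarrow> FI_emb n n p"
  unfolding FI_emb_def by (simp only: permutes_image permutes_inj_on order_refl simp_thms)

lemma FI_emb_comp: "FI_emb l m f \<Longrightarrow> FI_emb m n g \<Longrightarrow> FI_emb l n (g \<circ> f)"
proof -
  assume f: "FI_emb l m f" and g: "FI_emb m n g"
  have "inj_on g (f ` {1..l})"
    using f g inj_on_subset[of g "{1..m}" "f ` {1..l}"] by (simp add: FI_emb_def)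
  then have "inj_on (g \<circ> f) {1..l}" using f comp_inj_on[of f "{1..l}" g] by (simp add: FI_emb_def)
  moreover have "g ` f ` {1..l} \<subseteq> {1..n}"
    using f g image_mono[of "f ` {1..l}" "{1..m}" g] unfolding FI_emb_def by blast
  ultimately show ?thesis by (simp add: FI_emb_def image_comp)
qed

lemma FI_emb_le: "FI_emb m n f \<Longrightarrow> m \<le> n"
  using card_inj_on_le[of f "{1..m}" "{1..n}"] by (simp add: FI_emb_def)

lemma FI_emb_mono: "FI_emb m n f \<Longrightarrow> l \<le> m \<Longrightarrow> FI_emb l n f"
proof -
  assume f: "FI_emb m n f" and "l \<le> m"
  then have sub: "{1..l} \<subseteq> {1..m}" by auto
  show ?thesis
    using f inj_on_subset[OF _ sub, of f] image_mono[OF sub, of f] unfolding FI_emb_def by blast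
qed

lemma FI_act_cong: "(\<And>i. i \<in> {1..m} \<Longrightarrow> f i = g i) \<Longrightarrow> FI_act Z m n f x = FI_act Z m n g x"
  unfolding FI_act_def by (simp cong: restrict_cong)

text \<open>The partial injection sending \<open>f i\<close> to \<open>g i\<close> extends to all of
  \<open>[n]\<close>. This transitivity is why all injections induce the same map on orbits.\<close>

lemma FI_emb_extend:
  assumes "FI_emb l m f" "FI_emb l n g" "m \<le> n"
  shows "\<exists>p. p permutes {1..n} \<and> (\<forall>i\<in>{1..l}. p (f i) = g i)"
proof -
  let ?h = "g \<circ> inv_into {1..l} f"
  have h: "?h (f i) = g i" if "i \<in> {1..l}" for i
    using assms(1) that by (simp add: FI_emb_def)
  have inj: "inj_on ?h (f ` {1..l})"
  proof (rule inj_onI)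
    fix a b assume "a \<in> f ` {1..l}" "b \<in> f ` {1..l}" "?h a = ?h b"
    moreover from this obtain i j where ij: "i \<in> {1..l}" "a = f i" "j \<in> {1..l}" "b = f j" by blast
    ultimately have "g i = g j" using h by (simp del: comp_apply)
    then have "i = j" using ij assms(2) unfolding FI_emb_def by (blast dest: inj_onD)
    then show "a = b" using ij by simp
  qed
  have img: "?h ` f ` {1..l} \<subseteq> {1..n}" using h assms(2) by (auto simp: FI_emb_def)
  have "f ` {1..l} \<subseteq> {1..n}" using assms(1,3) by (auto simp: FI_emb_def)
  from inj_on_extends_to_permutation[OF finite_atLeastAtMost this inj img]
  obtain p where p: "p permutes {1..n}" "\<forall>i\<in>f ` {1..l}. p i = ?h i" by blast
  have "p (f i) = g i" if "i \<in> {1..l}" for i using p(2) h[OF that] that by (metis imageI)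
  then show ?thesis using p(1) by blast
qed

text \<open>At \<open>n = m\<close> the orbit of \<open>x\<close>, at larger \<open>n\<close> the
  whole orbit to which the induced maps send it.\<close>

definition spread :: "'a FI_data \<Rightarrow> nat \<Rightarrow> 'a \<Rightarrow> nat \<Rightarrow> 'a set" where
  "spread Z m x n = {FI_act Z m n f x | f. FI_emb m n f}"

context
  fixes Z :: "'a FI_data"
  assumes Z: "FI_set Z"
begin

lemma FI_act_in: "FI_emb m n f \<Longrightarrow> x \<in> FI_obj Z m \<Longrightarrow> FI_act Z m n f x \<in> FI_obj Z n"
proof -
  assume "FI_emb m n f" "x \<in> FI_obj Z m"
  moreover from this have "FI_map Z m n (restrict f {1..m}) \<in> FI_obj Z m \<rightarrow> FI_obj Z n"
    using Z FI_emb_restrict by (simp add: FI_set_def)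
  ultimately show ?thesis by (auto simp: FI_act_def)
qed

lemma FI_act_comp:
  assumes "FI_emb l m f" "FI_emb m n g" "x \<in> FI_obj Z l"
  shows "FI_act Z m n g (FI_act Z l m f x) = FI_act Z l n (g \<circ> f) x"
proof -
  have "compose {1..l} (restrict g {1..m}) (restrict f {1..l}) = restrict (g \<circ> f) {1..l}"
    using assms(1) by (auto simp: FI_emb_def compose_def restrict_def image_subset_iff fun_eq_iff)
  moreover have "FI_map Z l n (compose {1..l} (restrict g {1..m}) (restrict f {1..l})) x =
      FI_map Z m n (restrict g {1..m}) (FI_map Z l m (restrict f {1..l}) x)"
    using Z FI_emb_restrict[OF assms(1)] FI_emb_restrict[OF assms(2)] assms(3)
    unfolding FI_set_def by blast
  ultimately show ?thesis by (simp only: FI_act_def)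
qed

lemma FI_act_id: "x \<in> FI_obj Z n \<Longrightarrow> FI_act Z n n id x = x"
  using Z by (simp add: FI_set_def FI_act_def)

lemma finite_FI_obj: "finite (FI_obj Z n)"
  using Z by (simp add: FI_set_def)

lemma spread_subset: "x \<in> FI_obj Z m \<Longrightarrow> spread Z m x n \<subseteq> FI_obj Z n"
  using FI_act_in by (auto simp: spread_def)

lemma spread_refl: "x \<in> FI_obj Z n \<Longrightarrow> x \<in> spread Z n x n"
  unfolding spread_def using FI_emb_id[of n n] FI_act_id[of x n] by force

text \<open>Any injection of \<open>[l]\<close> into \<open>[n]\<close> differs from
  \<open>f\<close>, read as a map into \<open>[n]\<close>, by a permutation of \<open>[n]\<close>,
  so passing through the stage \<open>m\<close> loses nothing.\<close>

lemma spread_act: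
  assumes "FI_emb l m f" "x \<in> FI_obj Z l" "m \<le> n"
  shows "spread Z m (FI_act Z l m f x) n = spread Z l x n"
proof (intro equalityI subsetI)
  fix y assume "y \<in> spread Z m (FI_act Z l m f x) n"
  then show "y \<in> spread Z l x n"
    unfolding spread_def using FI_act_comp[OF assms(1) _ assms(2)] FI_emb_comp[OF assms(1)] by blast
next
  fix y assume "y \<in> spread Z l x n"
  then obtain g where g: "FI_emb l n g" "y = FI_act Z l n g x" by (auto simp: spread_def)
  obtain p where p: "p permutes {1..n}" "\<forall>i\<in>{1..l}. p (f i) = g i"
    using FI_emb_extend[OF assms(1) g(1) assms(3)] by blast
  have "FI_emb m n p" using p(1) assms(3) FI_emb_mono FI_emb_permutes by blast
  moreover have "y = FI_act Z m n p (FI_act Z l m f x)"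
    using FI_act_comp[OF assms(1) \<open>FI_emb m n p\<close> assms(2)] g(2) p(2)
      FI_act_cong[of l "p \<circ> f" g Z n x] by simp
  ultimately show "y \<in> spread Z m (FI_act Z l m f x) n" by (auto simp: spread_def)
qed

lemma spread_trans:
  assumes "x \<in> FI_obj Z l" "y \<in> spread Z l x m" "m \<le> n"
  shows "spread Z m y n = spread Z l x n"
proof -
  obtain f where "FI_emb l m f" "y = FI_act Z l m f x"
    using assms(2) unfolding spread_def by blast
  then show ?thesis using spread_act[OF _ assms(1,3)] by simp
qed

lemma spread_perm:
  assumes "x \<in> FI_obj Z n"
  shows "spread Z n x n = {FI_act Z n n p x | p. p permutes {1..n}}"
proof (intro equalityI subsetI)
  fix y assume "y \<in> spread Z n x n"
  then obtain f where f: "FI_emb n n f" "y = FI_act Z n n f x" by (auto simp: spread_def)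
  obtain p where p: "p permutes {1..n}" "\<forall>i\<in>{1..n}. p (id i) = f i"
    using FI_emb_extend[OF FI_emb_id f(1) order_refl] by blast
  then have "FI_act Z n n p x = FI_act Z n n f x" by (intro FI_act_cong) simp
  then show "y \<in> {FI_act Z n n p x | p. p permutes {1..n}}"
    using f(2) p(1) by (intro CollectI exI[of _ p]) simp
qed (use FI_emb_permutes in \<open>auto simp: spread_def\<close>)

end


subsection \<open>Supports and the size of an orbit\<close>

text \<open>What is meant is that all permutations moving only points outside \<open>A\<close> fix
  \<open>w\<close>. Transpositions suffice because they generate, as \<open>supports_fixed\<close>
  shows, and they are easy to conjugate.\<close>

definition supports :: "'a FI_data \<Rightarrow> nat \<Rightarrow> 'a \<Rightarrow> nat set \<Rightarrow> bool" where
  "supports Z n w A \<longleftrightarrow> (\<forall>i\<in>{1..n} - A. \<forall>j\<in>{1..n} - A. FI_act Z n n (Transposition.transpose i j) w = w)"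

lemma FI_emb_transpose: "i \<in> {1..n} \<Longrightarrow> j \<in> {1..n} \<Longrightarrow> FI_emb n n (Transposition.transpose i j)"
  by (intro FI_emb_permutes permutes_swap_id)

context
  fixes Z :: "'a FI_data"
  assumes Z: "FI_set Z"
begin

text \<open>For distinct points \<open>(i j)\<close> is the conjugate of \<open>(j l)\<close> by
  \<open>(i l)\<close>. Hence a single hub \<open>l\<close> controls all transpositions.\<close>

lemma fixed_by_transpose_trans:
  assumes w: "w \<in> FI_obj Z n" and ij: "i \<in> {1..n}" "j \<in> {1..n}" and l: "l \<in> {1..n}"
    and il: "FI_act Z n n (Transposition.transpose i l) w = w"
    and jl: "FI_act Z n n (Transposition.transpose j l) w = w"
  shows "FI_act Z n n (Transposition.transpose i j) w = w"
proof (cases "i = j \<or> i = l \<or> j = l")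
  case True
  then show ?thesis using il jl FI_act_id[OF Z w] by (auto simp: transpose_commute)
next
  case False
  then have eq: "Transposition.transpose i j =
      Transposition.transpose i l \<circ> (Transposition.transpose j l \<circ> Transposition.transpose i l)"
    by (auto simp: fun_eq_iff Transposition.transpose_def)
  note emb = FI_emb_transpose[OF ij(1) l] FI_emb_transpose[OF ij(2) l]
  show ?thesis
    by (simp only: eq il jl FI_act_comp[OF Z emb w, symmetric]
        FI_act_comp[OF Z FI_emb_comp[OF emb] emb(1) w, symmetric])
qed

text \<open>Every point outside \<open>A \<inter> B\<close> is outside \<open>A\<close> or outside
  \<open>B\<close>, so its transposition with the hub \<open>l\<close> fixes \<open>w\<close>. A
  common outside point is essential: for \<open>n = 2\<close> every element is supported by
  \<open>{1}\<close> and by \<open>{2}\<close>, yet not always by the empty set.\<close>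

lemma supports_Int:
  assumes w: "w \<in> FI_obj Z n" and A: "supports Z n w A" and B: "supports Z n w B"
    and l: "l \<in> {1..n}" "l \<notin> A \<union> B"
  shows "supports Z n w (A \<inter> B)"
proof -
  have "FI_act Z n n (Transposition.transpose i l) w = w" if "i \<in> {1..n} - A \<inter> B" for i
    using that A B l unfolding supports_def by blast
  then show ?thesis
    unfolding supports_def using fixed_by_transpose_trans[OF w _ _ l(1)] by blast
qed

lemma supports_fixed:
  assumes w: "w \<in> FI_obj Z n" and A: "supports Z n w A" and p: "p permutes C" and C: "C \<subseteq> {1..n} - A"
  shows "FI_act Z n n p w = w"
proof -
  have "finite C" using C finite_subset by blast
  with p show ?thesis
  proof (induction p rule: permutes_induct)
    case id
    show ?case by (rule FI_act_id[OF Z w])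
  next
    case (swap a b p)
    then have ab: "a \<in> {1..n} - A" "b \<in> {1..n} - A" and p: "p permutes {1..n}"
      using C permutes_subset[of p C "{1..n}"] by auto
    then have "FI_act Z n n (Transposition.transpose a b \<circ> p) w =
        FI_act Z n n (Transposition.transpose a b) (FI_act Z n n p w)"
      using FI_emb_transpose FI_emb_permutes by (intro FI_act_comp[OF Z _ _ w, symmetric]) auto
    also have "\<dots> = w" using swap A ab unfolding supports_def by simp
    finally show ?case .
  qed
qed

lemma supports_image:
  assumes w: "w \<in> FI_obj Z n" and A: "supports Z n w A" and p: "p permutes {1..n}"
  shows "supports Z n (FI_act Z n n p w) (p ` A)"
  unfolding supports_def
proof (intro ballI)
  fix i j assume i: "i \<in> {1..n} - p ` A" and j: "j \<in> {1..n} - p ` A"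
  define i' j' where "i' = inv p i" and "j' = inv p j"
  have "inv p k \<in> {1..n} - A" if "k \<in> {1..n} - p ` A" for k
    using that permutes_in_image[OF permutes_inv[OF p]] permutes_inverses(1)[OF p]
    by (metis Diff_iff image_eqI)
  then have i': "i' \<in> {1..n} - A" and j': "j' \<in> {1..n} - A"
    using i j by (auto simp: i'_def j'_def)
  have "Transposition.transpose i j \<circ> p = p \<circ> Transposition.transpose i' j'"
    using transpose_comp_eq[OF permutes_bij[OF p]] by (simp add: i'_def j'_def)
  then have "FI_act Z n n (Transposition.transpose i j) (FI_act Z n n p w) =
      FI_act Z n n p (FI_act Z n n (Transposition.transpose i' j') w)"
    using i j i' j' p w by (simp add: FI_act_comp[OF Z] FI_emb_transpose FI_emb_permutes)
  then show "FI_act Z n n (Transposition.transpose i j) (FI_act Z n n p w) = FI_act Z n n p w"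
    using A i' j' by (simp add: supports_def)
qed

lemma FI_act_inv:
  assumes "w \<in> FI_obj Z n" "p permutes {1..n}"
  shows "FI_act Z n n (inv p) (FI_act Z n n p w) = w"
    and "FI_act Z n n p (FI_act Z n n (inv p) w) = w"
proof -
  note emb = FI_emb_permutes[OF assms(2)] FI_emb_permutes[OF permutes_inv[OF assms(2)]]
  show "FI_act Z n n (inv p) (FI_act Z n n p w) = w"
    unfolding FI_act_comp[OF Z emb assms(1)] permutes_inv_o(2)[OF assms(2)]
    by (rule FI_act_id[OF Z assms(1)])
  show "FI_act Z n n p (FI_act Z n n (inv p) w) = w"
    unfolding FI_act_comp[OF Z emb(2,1) assms(1)] permutes_inv_o(1)[OF assms(2)]
    by (rule FI_act_id[OF Z assms(1)])
qed

lemma supports_start: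
  assumes "x \<in> FI_obj Z s" "s \<le> n"
  shows "supports Z n (FI_act Z s n id x) {1..s}"
  unfolding supports_def
proof (intro ballI)
  fix i j assume "i \<in> {1..n} - {1..s}" "j \<in> {1..n} - {1..s}"
  then show "FI_act Z n n (Transposition.transpose i j) (FI_act Z s n id x) = FI_act Z s n id x"
    using assms
    by (subst FI_act_comp[OF Z FI_emb_id FI_emb_transpose])
       (auto intro!: FI_act_cong simp: Transposition.transpose_def)
qed

text \<open>The hub is \<open>n\<close>, which lies outside \<open>A\<close>. Its transpositions
  with older points outside \<open>A\<close> already act trivially at stage \<open>n\<close>, and
  the one with \<open>Suc n\<close> moves only points above \<open>s\<close>. So each subset of
  \<open>{1..s}\<close> is eventually always or eventually never a support.\<close>

lemma supports_Suc:
  assumes x: "x \<in> FI_obj Z s" and n: "s < n" and A: "A \<subseteq> {1..s}"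
    and supp: "supports Z n (FI_act Z s n id x) A"
  shows "supports Z (Suc n) (FI_act Z s (Suc n) id x) A"
proof -
  let ?w = "FI_act Z s n id x" and ?w' = "FI_act Z s (Suc n) id x"
  have w: "?w \<in> FI_obj Z n" and w': "?w' \<in> FI_obj Z (Suc n)"
    using x n by (auto intro!: FI_act_in[OF Z] FI_emb_id)
  have w'_eq: "?w' = FI_act Z n (Suc n) id ?w"
    using FI_act_comp[OF Z FI_emb_id FI_emb_id x, of n "Suc n"] n by simp
  have old: "FI_act Z (Suc n) (Suc n) (Transposition.transpose i n) ?w' = ?w'"
    if i: "i \<in> {1..n} - A" for i
  proof -
    have "FI_act Z (Suc n) (Suc n) (Transposition.transpose i n) ?w' =
        FI_act Z n (Suc n) (id \<circ> Transposition.transpose i n) ?w"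
      unfolding w'_eq using i n w
      by (subst FI_act_comp[OF Z FI_emb_id FI_emb_transpose]) (auto intro!: FI_act_cong)
    also have "\<dots> = FI_act Z n (Suc n) id (FI_act Z n n (Transposition.transpose i n) ?w)"
      using i n w by (intro FI_act_comp[OF Z FI_emb_transpose FI_emb_id, symmetric]) auto
    also have "\<dots> = ?w'"
    proof -
      have "n \<in> {1..n} - A" using n A by auto
      then have "FI_act Z n n (Transposition.transpose i n) ?w = ?w"
        using supp i unfolding supports_def by blast
      then show ?thesis by (simp only: w'_eq)
    qed
    finally show ?thesis .
  qed
  have new: "FI_act Z (Suc n) (Suc n) (Transposition.transpose (Suc n) n) ?w' = ?w'"
    using supports_start[OF x, of "Suc n"] n unfolding supports_def by auto
  have "FI_act Z (Suc n) (Suc n) (Transposition.transpose i n) ?w' = ?w'"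
    if "i \<in> {1..Suc n} - A" for i
  proof (cases "i = Suc n")
    case False
    then have "i \<in> {1..n} - A" using that by auto
    then show ?thesis by (rule old)
  qed (use new in simp)
  moreover have "n \<in> {1..Suc n}" using n by simp
  ultimately show ?thesis
    unfolding supports_def using fixed_by_transpose_trans[OF w'] by blast
qed

text \<open>In the stable range every element of the orbit has a unique support of minimal size \<open>k\<close>. The
  elements with a given minimal support form sets of equal size, and this size does not increase
  with \<open>n\<close>.\<close>

lemma eventually_rational_card_spread:
  assumes x: "x \<in> FI_obj Z s"
  shows "eventually_rational (\<lambda>n. real (card (spread Z s x n)))"
proof -
  define w where "w n = FI_act Z s n id x" for n
  have w_in: "w n \<in> FI_obj Z n" if "s \<le> n" for n
    unfolding w_def using x that by (intro FI_act_in[OF Z] FI_emb_id)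
  \<comment> \<open>Candidates are the subsets of \<open>{1..s}\<close> that support eventually;
    this family does not depend on \<open>n\<close>, hence neither does the minimal size
    \<open>k\<close>.\<close>
  define \<S> where "\<S> = {A. A \<subseteq> {1..s} \<and> (\<forall>\<^sub>F n in sequentially. supports Z n (w n) A)}"
  have "\<forall>\<^sub>F n in sequentially. supports Z n (w n) {1..s}"
    unfolding eventually_sequentially w_def using supports_start[OF x] by blast
  then have "{1..s} \<in> \<S>" by (simp add: \<S>_def)
  then obtain A where A: "A \<in> \<S>" and min_\<S>: "\<And>B. B \<in> \<S> \<Longrightarrow> card A \<le> card B"
    using ex_has_least_nat[of "\<lambda>B. B \<in> \<S>" "{1..s}" card] by blast
  define k where "k = card A"
  have A_sub: "A \<subseteq> {1..s}" using A by (simp add: \<S>_def)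
  have k_le: "k \<le> s" using card_mono[OF _ A_sub] by (simp add: k_def)
  have "finite A" using A_sub finite_subset by blast
  \<comment> \<open>For large \<open>n\<close> the number of elements of the orbit with minimal
    support \<open>A\<close>. It may drop, because \<open>Z(f)\<close> need not be injective, but
    not grow, because the set at stage \<open>Suc n\<close> lies in the image of the one at stage
    \<open>n\<close>.\<close>
  define c where "c n = card {FI_act Z n n q (w n) | q. q permutes A}" for n
  have "c (Suc n) \<le> c n" if n: "n \<ge> s" for n
  proof -
    have "FI_act Z (Suc n) (Suc n) q (w (Suc n)) = FI_act Z n (Suc n) id (FI_act Z n n q (w n))"
      if q: "q permutes A" for q
    proof -
      have q': "q permutes {1..m}" if "m \<ge> s" for m
        using permutes_subset[OF q, of "{1..m}"] A_sub that by force
      have "w (Suc n) = FI_act Z n (Suc n) id (w n)"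
        unfolding w_def using FI_act_comp[OF Z FI_emb_id FI_emb_id x, of n "Suc n"] n by simp
      then show ?thesis
        using n q'[of n] q'[of "Suc n"] w_in[OF n]
        by (simp add: FI_act_comp[OF Z] FI_emb_id FI_emb_permutes)
    qed
    then have "{FI_act Z (Suc n) (Suc n) q (w (Suc n)) | q. q permutes A} \<subseteq>
        FI_act Z n (Suc n) id ` {FI_act Z n n q (w n) | q. q permutes A}" by auto
    moreover have "finite {FI_act Z n n q (w n) | q. q permutes A}"
      using finite_permutations[OF \<open>finite A\<close>] by simp
    ultimately show ?thesis unfolding c_def by (meson card_image_le card_mono finite_imageI le_trans)
  qed
  then obtain c' where c': "\<forall>\<^sub>F n in sequentially. c n = c'"
    by (rule eventually_constant_if_decreasing)
  \<comment> \<open>There are finitely many subsets, so beyond one threshold a subset that supports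
    at stage \<open>n\<close> supports eventually.\<close>
  have "\<forall>\<^sub>F n in sequentially. \<forall>B\<in>Pow {1..s}. supports Z n (w n) B \<longrightarrow> B \<in> \<S>"
  proof (intro eventually_ball_finite ballI)
    fix B assume B: "B \<in> Pow {1..s}"
    have "(\<forall>\<^sub>F n in sequentially. supports Z n (w n) B) \<or> (\<forall>\<^sub>F n in sequentially. \<not> supports Z n (w n) B)"
      by (rule eventually_monotone_predicate[of "Suc s"])
         (use supports_Suc[OF x] B in \<open>auto simp: w_def\<close>)
    then show "\<forall>\<^sub>F n in sequentially. supports Z n (w n) B \<longrightarrow> B \<in> \<S>"
    proof
      assume "\<forall>\<^sub>F n in sequentially. supports Z n (w n) B"
      then have "B \<in> \<S>" using B by (simp add: \<S>_def)
      then show ?thesis by simp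
    next
      assume "\<forall>\<^sub>F n in sequentially. \<not> supports Z n (w n) B"
      then show ?thesis by eventually_elim simp
    qed
  qed simp
  moreover have "\<forall>\<^sub>F n in sequentially. supports Z n (w n) A" using A by (simp add: \<S>_def)
  \<comment> \<open>Two supports of size at most \<open>s\<close> then leave a common point of
    \<open>[n]\<close> uncovered, as \<open>supports_Int\<close> demands.\<close>
  moreover have "\<forall>\<^sub>F n in sequentially. 2 * s < n" by (rule eventually_gt_at_top)
  ultimately have "\<forall>\<^sub>F n in sequentially. card (spread Z s x n) = (n choose k) * c n"
  proof eventually_elim
    case (elim n)
    note \<S>_n = elim(1) and A_n = elim(2) and n = elim(3)
    have wn: "w n \<in> FI_obj Z n" using w_in n by simp
    have A_sub_n: "A \<subseteq> {1..n}" using A_sub n by force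
    have T: "spread Z s x n = {FI_act Z n n p (w n) | p. p permutes {1..n}}"
      using spread_perm[OF Z wn] spread_act[OF Z FI_emb_id x, of n n] n by (simp add: w_def)
    have unique: "B = A" if B: "B \<subseteq> {1..n}" "card B = k" "supports Z n (w n) B" for B
    proof -
      have "card (A \<union> B) < card {1..n}"
        using card_Un_le[of A B] k_le n B(2) by (simp add: k_def)
      then have "\<not> {1..n} \<subseteq> A \<union> B"
        using card_mono[of "A \<union> B" "{1..n}"] \<open>finite A\<close> B(1) finite_subset by fastforce
      then obtain l where "l \<in> {1..n}" "l \<notin> A \<union> B" by blast
      then have "supports Z n (w n) (A \<inter> B)" by (rule supports_Int[OF wn A_n B(3)])
      then have "A \<inter> B \<in> \<S>" using \<S>_n A_sub by blast
      then have "card A \<le> card (A \<inter> B)" by (rule min_\<S>)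
      then have "A \<inter> B = A" using \<open>finite A\<close> by (intro card_seteq) auto
      then have "A \<subseteq> B" by blast
      then show ?thesis
        using B card_subset_eq[of B A] finite_subset by (metis finite_atLeastAtMost k_def)
    qed
    \<comment> \<open>The translates of \<open>w n\<close> with minimal support \<open>B\<close>;
      over the \<open>n choose k\<close> sets \<open>B\<close> they partition the orbit.\<close>
    define F where "F B = {FI_act Z n n p (w n) | p. p permutes {1..n} \<and> p ` A = B}" for B
    define \<B> where "\<B> = {B. B \<subseteq> {1..n} \<and> card B = k}"
    have supp_unique: "p ` A = B"
      if p: "p permutes {1..n}" and B: "B \<in> \<B>" "supports Z n (FI_act Z n n p (w n)) B" for p B
    proof -
      have inv: "inv p permutes {1..n}" by (rule permutes_inv[OF p])
      have "supports Z n (FI_act Z n n (inv p) (FI_act Z n n p (w n))) (inv p ` B)"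
        using FI_act_in[OF Z FI_emb_permutes[OF p] wn] B(2) inv by (rule supports_image)
      then have "supports Z n (w n) (inv p ` B)" by (simp add: FI_act_inv[OF wn p])
      moreover have "inv p ` B \<subseteq> {1..n}"
        using B(1) permutes_image[OF inv] by (auto simp: \<B>_def)
      moreover have "card (inv p ` B) = k"
        using B(1) by (simp add: \<B>_def card_image[OF permutes_inj_on[OF inv]])
      ultimately have "inv p ` B = A" using unique by blast
      then show ?thesis using permutes_inverses(1)[OF p] by (force simp: image_image)
    qed
    have supp: "supports Z n y B" if "y \<in> F B" for y B
      using that supports_image[OF wn A_n] by (auto simp: F_def)
    have union: "spread Z s x n = (\<Union>B\<in>\<B>. F B)"
    proof (intro equalityI subsetI)
      fix y assume "y \<in> spread Z s x n"
      then obtain p where p: "p permutes {1..n}" "y = FI_act Z n n p (w n)" unfolding T by blast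
      have "p ` A \<in> \<B>"
        using permutes_image[OF p(1)] A_sub_n card_image[OF permutes_inj_on[OF p(1)]]
        by (auto simp: \<B>_def k_def)
      then show "y \<in> (\<Union>B\<in>\<B>. F B)" using p by (auto simp: F_def)
    qed (auto simp: T F_def)
    have fin: "finite (F B)" for B
      using finite_permutations[of "{1..n}"] by (simp add: F_def)
    have disjoint: "F B \<inter> F C = {}" if "B \<in> \<B>" "C \<in> \<B>" "B \<noteq> C" for B C
    proof (rule ccontr)
      assume "F B \<inter> F C \<noteq> {}"
      then obtain y where y: "y \<in> F B" "y \<in> F C" by blast
      obtain p where p: "p permutes {1..n}" "p ` A = B" "y = FI_act Z n n p (w n)"
        using y(1) by (auto simp: F_def)
      have "p ` A = C" using supp_unique[OF p(1) that(2)] supp[OF y(2)] p(3) by simp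
      then show False using p(2) that(3) by simp
    qed
    have "card (F B) = card (F A)" if B: "B \<in> \<B>" for B
    proof -
      have "card A = card B" and "finite B"
        using B by (auto simp: \<B>_def k_def intro: finite_subset)
      then obtain f where f: "bij_betw f A B" using \<open>finite A\<close> finite_same_card_bij by blast
      have inj: "inj_on f A" and img: "f ` A \<subseteq> {1..n}" using f B by (auto simp: \<B>_def bij_betw_def)
      from inj_on_extends_to_permutation[OF finite_atLeastAtMost A_sub_n this]
      obtain p where p: "p permutes {1..n}" "\<forall>i\<in>A. p i = f i" by blast
      have pA: "p ` A = B" using p(2) f by (auto simp: bij_betw_def)
      have inv: "inv p permutes {1..n}" by (rule permutes_inv[OF p(1)])
      have pB: "inv p ` B = A" using permutes_inverses(2)[OF p(1)] pA by (force simp: image_image)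
      have push: "FI_act Z n n q ` F C \<subseteq> F (q ` C)" if q: "q permutes {1..n}" for q C
      proof
        fix y assume "y \<in> FI_act Z n n q ` F C"
        then obtain r where r: "r permutes {1..n}" "r ` A = C"
          and "y = FI_act Z n n q (FI_act Z n n r (w n))" by (auto simp: F_def)
        then have "y = FI_act Z n n (q \<circ> r) (w n)"
          using FI_act_comp[OF Z FI_emb_permutes[OF r(1)] FI_emb_permutes[OF q] wn] by simp
        moreover have "(q \<circ> r) ` A = q ` C" unfolding image_comp[symmetric] using r(2) by simp
        ultimately show "y \<in> F (q ` C)"
          unfolding F_def using permutes_compose[OF r(1) q] by blast
      qed
      have sub: "y \<in> FI_obj Z n" if "y \<in> F C" for y C
        using that FI_act_in[OF Z FI_emb_permutes wn] by (auto simp: F_def)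
      have "bij_betw (FI_act Z n n p) (F A) (F B)"
      proof (rule bij_betw_byWitness[of _ "FI_act Z n n (inv p)"])
        show "FI_act Z n n p ` F A \<subseteq> F B" using push[OF p(1), of A] pA by simp
        show "FI_act Z n n (inv p) ` F B \<subseteq> F A" using push[OF inv, of B] pB by simp
      qed (use FI_act_inv[OF sub p(1)] in blast)+
      then show ?thesis by (simp add: bij_betw_same_card)
    qed
    \<comment> \<open>A permutation preserving \<open>A\<close> splits into \<open>q\<close> acting
      inside \<open>A\<close> and \<open>r\<close> acting outside, and \<open>r\<close> fixes
      \<open>w n\<close> because \<open>A\<close> supports it.\<close>
    moreover have "F A = {FI_act Z n n q (w n) | q. q permutes A}"
    proof (intro equalityI subsetI)
      fix y assume "y \<in> F A"
      then obtain p where p: "p permutes {1..n}" "p ` A = A" "y = FI_act Z n n p (w n)"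
        by (auto simp: F_def)
      define q where "q i = (if i \<in> A then p i else i)" for i
      have q: "q permutes A"
        using permutes_inj_on[OF p(1), of A] p(2)
        by (intro bij_imp_permutes) (auto simp: q_def bij_betw_def inj_on_def)
      have q_n: "q permutes {1..n}" using permutes_subset[OF q A_sub_n] .
      define r where "r = inv q \<circ> p"
      have r_n: "r permutes {1..n}"
        unfolding r_def by (intro permutes_compose p(1) permutes_inv q_n)
      have "r permutes {1..n} - A"
      proof (rule permutes_superset[OF r_n])
        fix i assume "i \<in> {1..n} - ({1..n} - A)"
        then have "p i = q i" by (auto simp: q_def)
        then show "r i = i" by (simp add: r_def permutes_inverses(2)[OF q])
      qed
      then have "FI_act Z n n r (w n) = w n" by (intro supports_fixed[OF wn A_n]) auto
      moreover have "p = q \<circ> r"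
        by (simp add: r_def fun_eq_iff permutes_inverses(1)[OF q])
      ultimately have "y = FI_act Z n n q (w n)"
        using FI_act_comp[OF Z FI_emb_permutes[OF r_n] FI_emb_permutes[OF q_n] wn] p(3) by simp
      then show "y \<in> {FI_act Z n n q (w n) | q. q permutes A}" using q by blast
    next
      fix y assume "y \<in> {FI_act Z n n q (w n) | q. q permutes A}"
      then obtain q where "q permutes A" "y = FI_act Z n n q (w n)" by blast
      then show "y \<in> F A"
        using permutes_subset[OF _ A_sub_n] permutes_image by (fastforce simp: F_def)
    qed
    ultimately have card_F: "card (F B) = c n" if "B \<in> \<B>" for B
      using that by (simp add: c_def)
    have "finite \<B>" by (simp add: \<B>_def)
    then have "card (spread Z s x n) = (\<Sum>B\<in>\<B>. card (F B))"
      unfolding union using fin disjoint by (intro card_UN_disjoint) auto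
    also have "\<dots> = (n choose k) * c n"
      using card_F n_subsets[of "{1..n}" k] by (simp add: \<B>_def)
    finally show ?case .
  qed
  with c' have "\<forall>\<^sub>F n in sequentially. real (card (spread Z s x n)) = real (n choose k) * real c'"
    by eventually_elim simp
  then show ?thesis
    by (rule eventually_rational_cong[OF eventually_rational_mult[OF
          eventually_rational_binomial eventually_rational_const]])
qed

end


subsection \<open>Finite generation of products\<close>

lemma FI_act_prod: "FI_act (FI_prod Y Z) m n f = map_prod (FI_act Y m n f) (FI_act Z m n f)"
  by (simp add: FI_act_def FI_prod_def)

lemma FI_obj_prod: "FI_obj (FI_prod Y Z) n = FI_obj Y n \<times> FI_obj Z n"
  by (simp add: FI_prod_def)

lemma FI_set_prod:
  assumes "FI_set Y" "FI_set Z"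
  shows "FI_set (FI_prod Y Z)"
  using assms unfolding FI_set_def FI_prod_def by (auto simp: Pi_iff)

lemma generated_Suc_iff:
  "FI_obj Z (Suc n) = (\<Union>f\<in>FI_hom n (Suc n). FI_map Z n (Suc n) f ` FI_obj Z n) \<longleftrightarrow>
   FI_obj Z (Suc n) = {FI_act Z n (Suc n) f x | f x. FI_emb n (Suc n) f \<and> x \<in> FI_obj Z n}"
proof -
  have "(\<Union>f\<in>FI_hom n (Suc n). FI_map Z n (Suc n) f ` FI_obj Z n) =
      (\<Union>x\<in>FI_obj Z n. (\<lambda>f. FI_map Z n (Suc n) f x) ` FI_hom n (Suc n))" by blast
  also have "\<dots> = {FI_act Z n (Suc n) f x | f x. FI_emb n (Suc n) f \<and> x \<in> FI_obj Z n}"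
    unfolding FI_hom_image by blast
  finally show ?thesis by simp
qed

lemma finitely_generated_from:
  assumes Z: "FI_set Z" and "finitely_generated Z"
  shows "\<exists>d. \<forall>n\<ge>d. \<forall>y\<in>FI_obj Z n.
    \<exists>f x. FI_emb d n f \<and> x \<in> FI_obj Z d \<and> y = FI_act Z d n f x"
proof -
  obtain d where d: "\<And>n. d \<le> n \<Longrightarrow>
      FI_obj Z (Suc n) = {FI_act Z n (Suc n) f x | f x. FI_emb n (Suc n) f \<and> x \<in> FI_obj Z n}"
    using assms(2) unfolding finitely_generated_def generated_Suc_iff by blast
  have "\<exists>f x. FI_emb d n f \<and> x \<in> FI_obj Z d \<and> y = FI_act Z d n f x"
    if "d \<le> n" "y \<in> FI_obj Z n" for n y
    using that
  proof (induction n arbitrary: y rule: dec_induct)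
    case base
    have "FI_emb d d id" by (simp add: FI_emb_id)
    moreover have "y = FI_act Z d d id y" using FI_act_id[OF Z base] by (rule sym)
    ultimately show ?case using base by blast
  next
    case (step n)
    obtain g z where g: "FI_emb n (Suc n) g" "z \<in> FI_obj Z n" "y = FI_act Z n (Suc n) g z"
      using step.prems d[OF step.hyps(1)] by blast
    obtain f x where f: "FI_emb d n f" "x \<in> FI_obj Z d" "z = FI_act Z d n f x"
      using step.IH[OF g(2)] by blast
    have "y = FI_act Z d (Suc n) (g \<circ> f) x"
      unfolding g(3) f(3) by (rule FI_act_comp[OF Z f(1) g(1) f(2)])
    then show ?case using FI_emb_comp[OF f(1) g(1)] f(2) by blast
  qed
  then show ?thesis by blast
qed

text \<open>A pair coming from the generating stages \<open>d\<close> and \<open>e\<close> uses at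
  most \<open>d + e\<close> points of \<open>[n + 1]\<close>, so for \<open>d + e \<le> n\<close>
  some point \<open>i\<close> is missed by both injections. The transposition of \<open>i\<close>
  with \<open>n + 1\<close> pushes both into \<open>[n]\<close> and, being an involution, recovers
  the pair from there.\<close>

lemma finitely_generated_prod:
  assumes Y: "FI_set Y" "finitely_generated Y" and Z: "FI_set Z" "finitely_generated Z"
  shows "finitely_generated (FI_prod Y Z)"
proof -
  obtain d where d: "\<forall>n\<ge>d. \<forall>y\<in>FI_obj Y n.
      \<exists>f x. FI_emb d n f \<and> x \<in> FI_obj Y d \<and> y = FI_act Y d n f x"
    using finitely_generated_from[OF Y] ..
  obtain e where e: "\<forall>n\<ge>e. \<forall>y\<in>FI_obj Z n.
      \<exists>f x. FI_emb e n f \<and> x \<in> FI_obj Z e \<and> y = FI_act Z e n f x"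
    using finitely_generated_from[OF Z] ..
  let ?W = "FI_prod Y Z"
  have W: "FI_set ?W" using Y(1) Z(1) by (rule FI_set_prod)
  have "FI_obj ?W (Suc n) = {FI_act ?W n (Suc n) f x | f x. FI_emb n (Suc n) f \<and> x \<in> FI_obj ?W n}"
    if n: "d + e \<le> n" for n
  proof (intro equalityI subsetI)
    fix w assume "w \<in> FI_obj ?W (Suc n)"
    then obtain y z where w: "w = (y, z)" and y: "y \<in> FI_obj Y (Suc n)" and z: "z \<in> FI_obj Z (Suc n)"
      by (auto simp: FI_obj_prod)
    obtain f y' where f: "FI_emb d (Suc n) f" "y' \<in> FI_obj Y d" "y = FI_act Y d (Suc n) f y'"
      using d[rule_format, OF _ y] n by auto
    obtain g z' where g: "FI_emb e (Suc n) g" "z' \<in> FI_obj Z e" "z = FI_act Z e (Suc n) g z'"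
      using e[rule_format, OF _ z] n by auto
    have "card (f ` {1..d} \<union> g ` {1..e}) \<le> d + e"
      using card_Un_le[of "f ` {1..d}" "g ` {1..e}"] card_image_le[of "{1..d}" f]
        card_image_le[of "{1..e}" g] by simp
    then have "\<not> {1..Suc n} \<subseteq> f ` {1..d} \<union> g ` {1..e}"
      using card_mono[of "f ` {1..d} \<union> g ` {1..e}" "{1..Suc n}"] n by auto
    then obtain i where i: "i \<in> {1..Suc n}" "i \<notin> f ` {1..d}" "i \<notin> g ` {1..e}" by blast
    define \<tau> where "\<tau> = Transposition.transpose i (Suc n)"
    have \<tau>_perm: "\<tau> permutes {1..Suc n}"
      unfolding \<tau>_def using i(1) by (intro permutes_swap_id) auto
    have \<tau>: "FI_emb n (Suc n) \<tau>"
      using FI_emb_mono[OF FI_emb_permutes[OF \<tau>_perm]] by simp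
    have avoid: "FI_emb m n (\<tau> \<circ> h)" if h: "FI_emb m (Suc n) h" "i \<notin> h ` {1..m}" for m h
    proof -
      have "(\<tau> \<circ> h) j \<in> {1..n}" if "j \<in> {1..m}" for j
      proof -
        have "h j \<in> {1..Suc n}" "h j \<noteq> i" using h that unfolding FI_emb_def by blast+
        moreover from this have "\<tau> (h j) \<in> {1..Suc n}"
          using permutes_in_image[OF \<tau>_perm] by blast
        moreover have "\<tau> (h j) \<noteq> Suc n"
          using \<open>h j \<noteq> i\<close> unfolding \<tau>_def Transposition.transpose_def by (auto split: if_splits)
        ultimately show ?thesis by auto
      qed
      then show ?thesis
        using FI_emb_comp[OF h(1) FI_emb_permutes[OF \<tau>_perm]] unfolding FI_emb_def by blast
    qed
    have eq: "\<tau> \<circ> (\<tau> \<circ> h) = h" for h :: "nat \<Rightarrow> nat"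
      by (simp add: fun_eq_iff \<tau>_def)
    note f_avoid = avoid[OF f(1) i(2)] and g_avoid = avoid[OF g(1) i(3)]
    have "y = FI_act Y n (Suc n) \<tau> (FI_act Y d n (\<tau> \<circ> f) y')"
      using FI_act_comp[OF Y(1) f_avoid \<tau> f(2)] f(3) unfolding eq by simp
    moreover have "z = FI_act Z n (Suc n) \<tau> (FI_act Z e n (\<tau> \<circ> g) z')"
      using FI_act_comp[OF Z(1) g_avoid \<tau> g(2)] g(3) unfolding eq by simp
    ultimately have "w = FI_act ?W n (Suc n) \<tau> (FI_act Y d n (\<tau> \<circ> f) y', FI_act Z e n (\<tau> \<circ> g) z')"
      by (simp add: FI_act_prod w)
    moreover have "(FI_act Y d n (\<tau> \<circ> f) y', FI_act Z e n (\<tau> \<circ> g) z') \<in> FI_obj ?W n"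
      using FI_act_in[OF Y(1) f_avoid f(2)] FI_act_in[OF Z(1) g_avoid g(2)] by (simp add: FI_obj_prod)
    ultimately show "w \<in> {FI_act ?W n (Suc n) f x | f x. FI_emb n (Suc n) f \<and> x \<in> FI_obj ?W n}"
      using \<tau> by blast
  next
    fix w assume "w \<in> {FI_act ?W n (Suc n) f x | f x. FI_emb n (Suc n) f \<and> x \<in> FI_obj ?W n}"
    then show "w \<in> FI_obj ?W (Suc n)" using FI_act_in[OF W] by blast
  qed
  then show ?thesis unfolding finitely_generated_def generated_Suc_iff by blast
qed


subsection \<open>Stable orbits\<close>

lemma orbits_eq_spread:
  assumes "FI_set Z"
  shows "orbits Z n = (\<lambda>x. spread Z n x n) ` FI_obj Z n"
proof -
  have "orbit_rel Z n `` {x} = spread Z n x n" if "x \<in> FI_obj Z n" for x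
    unfolding orbit_rel_def spread_def FI_hom_image[symmetric] using that by blast
  then show ?thesis unfolding orbits_def quotient_def by blast
qed

lemma orbit_map_spread:
  assumes Z: "FI_set Z" and x: "x \<in> FI_obj Z n"
  shows "orbit_map Z n (spread Z n x n) = spread Z n x (Suc n)"
proof -
  have "orbit_map Z n (spread Z n x n) = (\<Union>y\<in>spread Z n x n. spread Z n y (Suc n))"
    unfolding orbit_map_def spread_def[of Z n _ "Suc n"] FI_hom_image[symmetric] by blast
  also have "\<dots> = (\<Union>y\<in>spread Z n x n. spread Z n x (Suc n))"
    using spread_trans[OF Z x] by (intro SUP_cong) auto
  also have "\<dots> = spread Z n x (Suc n)" using spread_refl[OF Z x] by blast
  finally show ?thesis .
qed

context
  fixes W :: "'a FI_data"
  assumes W: "FI_set W" and fg: "finitely_generated W"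
begin

lemma orbit_map_in: "X \<in> orbits W n \<Longrightarrow> orbit_map W n X \<in> orbits W (Suc n)"
proof -
  assume "X \<in> orbits W n"
  then obtain x where x: "x \<in> FI_obj W n" "X = spread W n x n"
    unfolding orbits_eq_spread[OF W] by blast
  have emb: "FI_emb n (Suc n) id" by (simp add: FI_emb_id)
  have "orbit_map W n X = spread W (Suc n) (FI_act W n (Suc n) id x) (Suc n)"
    unfolding x(2) orbit_map_spread[OF W x(1)] by (rule spread_act[OF W emb x(1) order_refl, symmetric])
  then show ?thesis
    unfolding orbits_eq_spread[OF W] using FI_act_in[OF W emb x(1)] by blast
qed

lemma finite_orbits: "finite (orbits W n)"
  unfolding orbits_eq_spread[OF W] using finite_FI_obj[OF W] by simp

text \<open>As \<open>stable_start\<close> is a \<open>LEAST\<close>, some admissible index must be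
  exhibited. Finite generation makes the induced maps surjective from some stage on; the numbers of
  orbits then decrease, hence become constant, and the surjections become bijections.\<close>

lemma stable_bij:
  assumes "stable_start W \<le> n"
  shows "bij_betw (orbit_map W n) (orbits W n) (orbits W (Suc n))"
proof -
  obtain d where d: "\<And>n. d \<le> n \<Longrightarrow>
      FI_obj W (Suc n) = {FI_act W n (Suc n) f x | f x. FI_emb n (Suc n) f \<and> x \<in> FI_obj W n}"
    using fg unfolding finitely_generated_def generated_Suc_iff by blast
  have surj: "orbit_map W n ` orbits W n = orbits W (Suc n)" if n: "d \<le> n" for n
  proof (intro equalityI subsetI)
    fix Y assume "Y \<in> orbits W (Suc n)"
    then obtain y where y: "y \<in> FI_obj W (Suc n)" "Y = spread W (Suc n) y (Suc n)"
      unfolding orbits_eq_spread[OF W] by blast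
    obtain f x where f: "FI_emb n (Suc n) f" "x \<in> FI_obj W n" "y = FI_act W n (Suc n) f x"
      using y(1) d[OF n] by blast
    have "Y = orbit_map W n (spread W n x n)"
      unfolding orbit_map_spread[OF W f(2)] y(2) f(3) by (rule spread_act[OF W f(1,2) order_refl])
    then show "Y \<in> orbit_map W n ` orbits W n"
      unfolding orbits_eq_spread[OF W] using f(2) by blast
  qed (use orbit_map_in in blast)
  have "card (orbits W (Suc n)) \<le> card (orbits W n)" if "d \<le> n" for n
    using card_image_le[OF finite_orbits, of "orbit_map W n" n] surj[OF that] by simp
  then obtain c where "\<forall>\<^sub>F n in sequentially. card (orbits W n) = c"
    by (rule eventually_constant_if_decreasing)
  then obtain m where m: "\<And>n. m \<le> n \<Longrightarrow> card (orbits W n) = c"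
    unfolding eventually_sequentially by blast
  have "\<forall>n\<ge>max d m. bij_betw (orbit_map W n) (orbits W n) (orbits W (Suc n))"
  proof (intro allI impI)
    fix n assume "max d m \<le> n"
    then have n: "d \<le> n" "m \<le> n" "m \<le> Suc n" by simp_all
    have "inj_on (orbit_map W n) (orbits W n)"
      by (rule eq_card_imp_inj_on[OF finite_orbits]) (simp add: surj[OF n(1)] m[OF n(2)] m[OF n(3)])
    then show "bij_betw (orbit_map W n) (orbits W n) (orbits W (Suc n))"
      using surj[OF n(1)] by (simp add: bij_betw_def)
  qed
  then have "\<forall>n\<ge>stable_start W. bij_betw (orbit_map W n) (orbits W n) (orbits W (Suc n))"
    unfolding stable_start_def by (rule LeastI)
  then show ?thesis using assms by blast
qed

text \<open>Members in the stable range determine each other through the induced bijections, and the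
  prescribed \<open>{}\<close> below that range leaves no further freedom.\<close>

lemma stable_orbits_bij:
  assumes "stable_start W \<le> n"
  shows "bij_betw (\<lambda>\<O>. \<O> n) (stable_orbits W) (orbits W n)"
  using assms
proof (induction n rule: dec_induct)
  case base
  let ?s = "stable_start W"
  show ?case
  proof (rule bij_betw_imageI)
    show "inj_on (\<lambda>\<O>. \<O> ?s) (stable_orbits W)"
    proof (intro inj_onI ext)
      fix \<O> \<O>' n
      assume \<O>: "\<O> \<in> stable_orbits W" "\<O>' \<in> stable_orbits W" and eq: "\<O> ?s = \<O>' ?s"
      show "\<O> n = \<O>' n"
      proof (cases "?s \<le> n")
        case True
        then show ?thesis
        proof (induction n rule: dec_induct)
          case (step n)
          then show ?case using \<O> by (simp add: stable_orbits_def)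
        qed (rule eq)
      qed (use \<O> in \<open>simp add: stable_orbits_def\<close>)
    qed
    show "(\<lambda>\<O>. \<O> ?s) ` stable_orbits W = orbits W ?s"
    proof (intro equalityI subsetI)
      fix X assume X: "X \<in> orbits W ?s"
      define \<O> where "\<O> n = (if n < ?s then {} else rec_nat X (\<lambda>k. orbit_map W (?s + k)) (n - ?s))" for n
      have Suc: "\<O> (Suc n) = orbit_map W n (\<O> n)" if "?s \<le> n" for n
        using that by (simp add: \<O>_def Suc_diff_le)
      have "\<O> n \<in> orbits W n" if "?s \<le> n" for n
        using that
      proof (induction n rule: dec_induct)
        case (step n)
        then show ?case by (simp add: Suc orbit_map_in)
      qed (simp add: \<O>_def X)
      then have "\<forall>n\<ge>?s. \<O> n \<in> orbits W n \<and> \<O> (Suc n) = orbit_map W n (\<O> n)"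
        using Suc by blast
      moreover have "\<forall>n<?s. \<O> n = {}" by (simp add: \<O>_def)
      ultimately have "\<O> \<in> stable_orbits W" unfolding stable_orbits_def by blast
      moreover have "\<O> ?s = X" by (simp add: \<O>_def)
      ultimately show "X \<in> (\<lambda>\<O>. \<O> ?s) ` stable_orbits W" by blast
    qed (auto simp: stable_orbits_def)
  qed
next
  case (step n)
  have "bij_betw (orbit_map W n \<circ> (\<lambda>\<O>. \<O> n)) (stable_orbits W) (orbits W (Suc n))"
    using step.IH stable_bij[OF step.hyps(1)] by (rule bij_betw_trans)
  moreover have "\<O> (Suc n) = (orbit_map W n \<circ> (\<lambda>\<O>. \<O> n)) \<O>" if "\<O> \<in> stable_orbits W" for \<O>
    using that step.hyps(1) by (simp add: stable_orbits_def)
  ultimately show ?case by (subst bij_betw_cong)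
qed

lemma finite_stable_orbits: "finite (stable_orbits W)"
  using bij_betw_finite[OF stable_orbits_bij[OF order_refl]] finite_orbits by blast

lemma stable_orbit_eq_spread:
  assumes "\<O> \<in> stable_orbits W" "stable_start W \<le> m" "x \<in> \<O> m" "m \<le> n"
  shows "x \<in> FI_obj W m" and "\<O> n = spread W m x n"
proof -
  have "\<O> m \<in> orbits W m" using assms(1,2) by (simp add: stable_orbits_def)
  then obtain y where y: "y \<in> FI_obj W m" "\<O> m = spread W m y m"
    unfolding orbits_eq_spread[OF W] by blast
  then show x: "x \<in> FI_obj W m" using assms(3) spread_subset[OF W y(1)] by blast
  have base: "\<O> m = spread W m x m"
    using spread_trans[OF W y(1), of x m m] assms(3) y(2) by simp
  show "\<O> n = spread W m x n" using assms(4)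
  proof (induction n rule: dec_induct)
    case (step n)
    have emb: "FI_emb m n id" using step.hyps(1) by (rule FI_emb_id)
    let ?z = "FI_act W m n id x"
    have "\<O> (Suc n) = orbit_map W n (\<O> n)"
      using assms(1,2) step.hyps(1) by (simp add: stable_orbits_def)
    also have "\<O> n = spread W n ?z n"
      unfolding step.IH by (rule spread_act[OF W emb x order_refl, symmetric])
    also have "orbit_map W n \<dots> = spread W n ?z (Suc n)"
      by (rule orbit_map_spread[OF W FI_act_in[OF W emb x]])
    also have "\<dots> = spread W m x (Suc n)" by (rule spread_act[OF W emb x]) simp
    finally show ?case .
  qed (rule base)
qed

lemma stable_orbit_nonempty:
  assumes "\<O> \<in> stable_orbits W" "stable_start W \<le> n"
  shows "\<O> n \<noteq> {}"
proof -
  have "\<O> n \<in> orbits W n" using assms by (simp add: stable_orbits_def)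
  then show ?thesis unfolding orbits_eq_spread[OF W] using spread_refl[OF W] by blast
qed

lemma stable_orbit_unique:
  assumes "stable_start W \<le> n" "x \<in> FI_obj W n"
  shows "\<exists>!\<O>. \<O> \<in> stable_orbits W \<and> x \<in> \<O> n"
proof -
  have "spread W n x n \<in> orbits W n" unfolding orbits_eq_spread[OF W] using assms(2) by blast
  then obtain \<O> where \<O>: "\<O> \<in> stable_orbits W" "\<O> n = spread W n x n"
    using stable_orbits_bij[OF assms(1)] by (metis (no_types, lifting) bij_betw_def imageE)
  show ?thesis
  proof (rule ex1I[of _ \<O>])
    show "\<O> \<in> stable_orbits W \<and> x \<in> \<O> n" using \<O> spread_refl[OF W assms(2)] by simp
  next
    fix \<O>' assume \<O>': "\<O>' \<in> stable_orbits W \<and> x \<in> \<O>' n"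
    then have "\<O>' n = \<O> n" using stable_orbit_eq_spread(2)[of \<O>' n x n] assms(1) \<O>(2) by simp
    then show "\<O>' = \<O>"
      using stable_orbits_bij[OF assms(1)] \<O>(1) \<O>' by (auto simp: bij_betw_def inj_on_def)
  qed
qed

lemma stable_orbit_act:
  assumes "\<O> \<in> stable_orbits W" "stable_start W \<le> m" "x \<in> \<O> m" "FI_emb m n f"
  shows "FI_act W m n f x \<in> \<O> n"
  using stable_orbit_eq_spread(2)[OF assms(1-3) FI_emb_le[OF assms(4)]] assms(4)
  unfolding spread_def by blast

lemma eventually_rational_card_stable_orbit:
  assumes "\<O> \<in> stable_orbits W"
  shows "eventually_rational (\<lambda>n. real (card (\<O> n)))"
proof -
  let ?s = "stable_start W"
  obtain x where x: "x \<in> \<O> ?s" using stable_orbit_nonempty[OF assms order_refl] by blast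
  have "\<forall>n\<ge>?s. real (card (\<O> n)) = real (card (spread W ?s x n))"
    using stable_orbit_eq_spread(2)[OF assms order_refl x] by simp
  then have "\<forall>\<^sub>F n in sequentially. real (card (\<O> n)) = real (card (spread W ?s x n))"
    unfolding eventually_sequentially by blast
  then show ?thesis
    using eventually_rational_card_spread[OF W stable_orbit_eq_spread(1)[OF assms order_refl x order_refl]]
    by (rule eventually_rational_cong[rotated])
qed

text \<open>A single element of \<open>\<O> n\<close> generates \<open>\<O> (Suc n)\<close>, so
  containment at one stage is inherited by the next.\<close>

lemma stable_orbit_eventually_in:
  assumes closed: "\<And>n f x. N \<le> n \<Longrightarrow> FI_emb n (Suc n) f \<Longrightarrow> x \<in> V n \<Longrightarrow>
      FI_act W n (Suc n) f x \<in> V (Suc n)"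
    and \<O>: "\<O> \<in> stable_orbits W"
  shows "(\<forall>\<^sub>F n in sequentially. \<O> n \<subseteq> V n) \<or> (\<forall>\<^sub>F n in sequentially. \<not> \<O> n \<subseteq> V n)"
proof (rule eventually_monotone_predicate[of "max N (stable_start W)"])
  fix n assume n: "max N (stable_start W) \<le> n" and sub: "\<O> n \<subseteq> V n"
  obtain x where x: "x \<in> \<O> n" using stable_orbit_nonempty[OF \<O>, of n] n by auto
  have "\<O> (Suc n) = spread W n x (Suc n)"
    using stable_orbit_eq_spread(2)[OF \<O> _ x, of "Suc n"] n by simp
  then show "\<O> (Suc n) \<subseteq> V (Suc n)"
    using closed[of n] n x sub unfolding spread_def by auto
qed

text \<open>At each large stage \<open>V n\<close> is a disjoint union of orbits. Each of the
  finitely many stable orbits is eventually inside \<open>V n\<close> or eventually not, so the list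
  of constituents stops changing and their cardinalities add up.\<close>

lemma eventually_rational_card_invariant:
  assumes sub: "\<And>n. N \<le> n \<Longrightarrow> V n \<subseteq> FI_obj W n"
    and closed: "\<And>m n f x. N \<le> m \<Longrightarrow> FI_emb m n f \<Longrightarrow> x \<in> V m \<Longrightarrow> FI_act W m n f x \<in> V n"
  shows "eventually_rational (\<lambda>n. real (card (V n)))"
proof -
  define J where "J = {\<O> \<in> stable_orbits W. \<forall>\<^sub>F n in sequentially. \<O> n \<subseteq> V n}"
  have "finite J" using finite_stable_orbits by (simp add: J_def)
  have "\<forall>\<^sub>F n in sequentially. \<forall>\<O>\<in>stable_orbits W. \<O> n \<subseteq> V n \<longleftrightarrow> \<O> \<in> J"
  proof (intro eventually_ball_finite finite_stable_orbits ballI)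
    fix \<O> assume \<O>: "\<O> \<in> stable_orbits W"
    show "\<forall>\<^sub>F n in sequentially. \<O> n \<subseteq> V n \<longleftrightarrow> \<O> \<in> J"
    proof (cases "\<O> \<in> J")
      case True
      then show ?thesis by (simp add: J_def)
    next
      case False
      then show ?thesis
        using stable_orbit_eventually_in[OF closed \<O>] \<O> by (simp add: J_def)
    qed
  qed
  moreover have "\<forall>\<^sub>F n in sequentially. max N (stable_start W) \<le> n" by (rule eventually_ge_at_top)
  ultimately have "\<forall>\<^sub>F n in sequentially. real (card (V n)) = (\<Sum>\<O>\<in>J. real (card (\<O> n)))"
  proof eventually_elim
    case (elim n)
    then have n: "N \<le> n" "stable_start W \<le> n" by simp_all
    have J: "\<O> \<in> stable_orbits W" "\<O> n \<subseteq> V n" if "\<O> \<in> J" for \<O>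
      using that elim(1) by (auto simp: J_def)
    have "V n = (\<Union>\<O>\<in>J. \<O> n)"
    proof (intro equalityI subsetI)
      fix x assume x: "x \<in> V n"
      then have "x \<in> FI_obj W n" using sub[OF n(1)] by blast
      then obtain \<O> where \<O>: "\<O> \<in> stable_orbits W" "x \<in> \<O> n"
        using stable_orbit_unique[OF n(2)] by blast
      have "\<O> n \<subseteq> V n"
        using stable_orbit_eq_spread(2)[OF \<O>(1) n(2) \<O>(2) order_refl] closed[OF n(1) _ x, of n]
        unfolding spread_def by auto
      then show "x \<in> (\<Union>\<O>\<in>J. \<O> n)" using elim(1) \<O> by blast
    qed (use J(2) in blast)
    moreover have "finite (\<O> n)" if "\<O> \<in> J" for \<O>
      using J(2)[OF that] sub[OF n(1)] finite_FI_obj[OF W] by (meson finite_subset)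
    moreover have "\<O> n \<inter> \<O>' n = {}" if \<O>: "\<O> \<in> J" "\<O>' \<in> J" "\<O> \<noteq> \<O>'" for \<O> \<O>'
    proof (rule ccontr)
      assume "\<O> n \<inter> \<O>' n \<noteq> {}"
      then obtain x where x: "x \<in> \<O> n" "x \<in> \<O>' n" by blast
      have "x \<in> FI_obj W n" using x(1) J(2)[OF \<O>(1)] sub[OF n(1)] by blast
      then show False using stable_orbit_unique[OF n(2)] x J(1) \<O> by metis
    qed
    ultimately have "card (V n) = (\<Sum>\<O>\<in>J. card (\<O> n))"
      using \<open>finite J\<close> by (simp add: card_UN_disjoint)
    then show ?case by simp
  qed
  then show ?thesis
    by (rule eventually_rational_cong[rotated])
       (intro eventually_rational_sum eventually_rational_card_stable_orbit, simp add: J_def)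
qed

end


section \<open>The linear systems on stable orbits\<close>

subsection \<open>Invariance of hitting time moments\<close>

context
  fixes S :: "'a set" and Q :: "'a \<Rightarrow> 'a \<Rightarrow> real" and \<phi> :: "'a \<Rightarrow> 'a"
  assumes \<phi>: "bij_betw \<phi> S S" and inv: "\<And>x y. x \<in> S \<Longrightarrow> y \<in> S \<Longrightarrow> Q (\<phi> x) (\<phi> y) = Q x y"
begin

text \<open>An automorphism of the chain moves the target along with the start. Allowing any
  transported pair \<open>w\<close>, \<open>w'\<close> makes the fact serve both moments.\<close>

lemma killed_step_pow_invariant:
  assumes b: "b \<in> S" and w: "\<And>x. x \<in> S \<Longrightarrow> w' (\<phi> x) = w x" and "x \<in> S"
  shows "(killed_step S Q (\<phi> b) ^^ t) w' (\<phi> x) = (killed_step S Q b ^^ t) w x"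
  using assms(3)
proof (induction t arbitrary: x)
  case (Suc t)
  let ?w' = "(killed_step S Q (\<phi> b) ^^ t) w'" and ?w = "(killed_step S Q b ^^ t) w"
  have "(\<Sum>c\<in>S. Q (\<phi> x) c * ?w' c) = (\<Sum>c\<in>S. Q (\<phi> x) (\<phi> c) * ?w' (\<phi> c))"
    by (rule sum.reindex_bij_betw[OF \<phi>, symmetric])
  also have "\<dots> = (\<Sum>c\<in>S. Q x c * ?w c)"
    using Suc inv by (intro sum.cong) auto
  finally have "(\<Sum>c\<in>S. Q (\<phi> x) c * ?w' c) = (\<Sum>c\<in>S. Q x c * ?w c)" .
  moreover have "\<phi> x = \<phi> b \<longleftrightarrow> x = b"
    using \<phi> b Suc.prems by (auto simp: bij_betw_def inj_on_def)
  ultimately show ?case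
    by (simp add: killed_step_def[of S Q "\<phi> b" ?w' "\<phi> x"] killed_step_def[of S Q b ?w x])
qed (simp add: w)

lemma hit_mean_invariant:
  assumes "a \<in> S" "b \<in> S"
  shows "hit_mean S Q (\<phi> b) (\<phi> a) = hit_mean S Q b a"
  unfolding hit_mean_def potential_def using assms \<phi>
  by (intro suminf_cong killed_step_pow_invariant) (auto simp: bij_betw_def inj_on_def)

lemma hit_second_invariant:
  assumes "a \<in> S" "b \<in> S"
  shows "hit_second S Q (\<phi> b) (\<phi> a) = hit_second S Q b a"
  unfolding hit_second_def potential_def using assms hit_mean_invariant
  by (intro suminf_cong killed_step_pow_invariant) auto

end


subsection \<open>Structure constants\<close>

definition orbit_triples :: "'a family \<Rightarrow> 'a family \<Rightarrow> 'a family \<Rightarrow> nat \<Rightarrow> ('a \<times> 'a \<times> 'a) set" where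
  "orbit_triples \<O> \<O>1 \<O>2 n = {(a, c, b). (a, b) \<in> \<O> n \<and> (a, c) \<in> \<O>1 n \<and> (c, b) \<in> \<O>2 n}"

text \<open>A quotient of cardinalities of invariant families, because the intermediate points of
  one fixed pair do not form such a family. These are the structure constants of the algebra spanned
  by the orbit matrices.\<close>

definition structure_constant :: "'a family \<Rightarrow> 'a family \<Rightarrow> 'a family \<Rightarrow> nat \<Rightarrow> real" where
  "structure_constant \<O> \<O>1 \<O>2 n =
     real (card (orbit_triples \<O> \<O>1 \<O>2 n)) / real (card (\<O> n))"

locale fg_FI_set =
  fixes Z :: "'a FI_data"
  assumes FI_set: "FI_set Z" and fg: "finitely_generated Z"
begin

abbreviation "ZZ \<equiv> FI_prod Z Z"
abbreviation "J \<equiv> stable_orbits ZZ"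
abbreviation "start \<equiv> stable_start ZZ"

lemma FI_set_ZZ: "FI_set ZZ" and fg_ZZ: "finitely_generated ZZ"
  using FI_set_prod[OF FI_set FI_set] finitely_generated_prod[OF FI_set fg FI_set fg] by auto

lemma pair_in_obj:
  assumes "\<O> \<in> J" "start \<le> n" "(a, b) \<in> \<O> n"
  shows "a \<in> FI_obj Z n" and "b \<in> FI_obj Z n"
  using stable_orbit_eq_spread(1)[OF FI_set_ZZ fg_ZZ assms order_refl] by (auto simp: FI_obj_prod)

lemma pair_act:
  assumes "\<O> \<in> J" "start \<le> m" "(a, b) \<in> \<O> m" "FI_emb m n f"
  shows "(FI_act Z m n f a, FI_act Z m n f b) \<in> \<O> n"
  using stable_orbit_act[OF FI_set_ZZ fg_ZZ assms] by (simp add: FI_act_prod)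

lemma pair_transitive:
  assumes "\<O> \<in> J" "start \<le> n" "(a, b) \<in> \<O> n" "(a', b') \<in> \<O> n"
  obtains p where "p permutes {1..n}" "a' = FI_act Z n n p a" "b' = FI_act Z n n p b"
proof -
  note orb = stable_orbit_eq_spread[OF FI_set_ZZ fg_ZZ assms(1-3) order_refl]
  have "(a', b') \<in> {FI_act ZZ n n p (a, b) | p. p permutes {1..n}}"
    using assms(4) unfolding orb(2) spread_perm[OF FI_set_ZZ orb(1)] .
  then show ?thesis using that by (auto simp: FI_act_prod)
qed

lemma pair_orbit_ex:
  assumes "start \<le> n" "a \<in> FI_obj Z n" "b \<in> FI_obj Z n"
  obtains \<O> where "\<O> \<in> J" "(a, b) \<in> \<O> n"
  using stable_orbit_unique[OF FI_set_ZZ fg_ZZ assms(1), of "(a, b)"] assms(2,3)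
  by (auto simp: FI_obj_prod)

lemma pair_orbit_unique:
  assumes "start \<le> n" "\<O> \<in> J" "\<O>' \<in> J" "(a, b) \<in> \<O> n" "(a, b) \<in> \<O>' n"
  shows "\<O>' = \<O>"
proof -
  have "(a, b) \<in> FI_obj ZZ n" using pair_in_obj[OF assms(2,1,4)] by (simp add: FI_obj_prod)
  then show ?thesis
    using stable_orbit_unique[OF FI_set_ZZ fg_ZZ assms(1)] assms(2-) by blast
qed

lemma finite_J: "finite J"
  by (rule finite_stable_orbits[OF FI_set_ZZ fg_ZZ])

lemma finite_orbit:
  assumes "\<O> \<in> J" "start \<le> n"
  shows "finite (\<O> n)"
proof (rule finite_subset)
  show "\<O> n \<subseteq> FI_obj Z n \<times> FI_obj Z n" using pair_in_obj[OF assms] by auto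
  show "finite (FI_obj Z n \<times> FI_obj Z n)" using finite_FI_obj[OF FI_set] by simp
qed

lemma sum_over_orbits:
  fixes f :: "'a family \<Rightarrow> real"
  assumes "start \<le> n" "\<O> \<in> J" "(a, b) \<in> \<O> n"
  shows "(\<Sum>\<O>'\<in>J. f \<O>' * of_bool ((a, b) \<in> \<O>' n)) = f \<O>"
proof -
  have "(a, b) \<in> \<O>' n \<longleftrightarrow> \<O>' = \<O>" if "\<O>' \<in> J" for \<O>'
    using pair_orbit_unique[OF assms(1,2) that assms(3)] assms(3) by blast
  then have "(\<Sum>\<O>'\<in>J. f \<O>' * of_bool ((a, b) \<in> \<O>' n)) = (\<Sum>\<O>'\<in>J. if \<O>' = \<O> then f \<O> else 0)"
    by (intro sum.cong) auto
  then show ?thesis using finite_J assms(2) by simp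
qed

lemma specialize_on_orbit:
  assumes "start \<le> n" "\<O> \<in> J" "(a, b) \<in> \<O> n"
  shows "specialize Z r n a b = eval_ratfun (r \<O>) (real n)"
  unfolding specialize_def orbit_matrix_def by (rule sum_over_orbits[OF assms])

lemma eventually_rational_structure_constant:
  assumes \<O>: "\<O> \<in> J" "\<O>1 \<in> J" "\<O>2 \<in> J"
  shows "eventually_rational (structure_constant \<O> \<O>1 \<O>2)"
proof -
  let ?W = "FI_prod Z ZZ"
  have W: "FI_set ?W" "finitely_generated ?W"
    using FI_set_prod[OF FI_set FI_set_ZZ] finitely_generated_prod[OF FI_set fg FI_set_ZZ fg_ZZ] by auto
  have "eventually_rational (\<lambda>n. real (card (orbit_triples \<O> \<O>1 \<O>2 n)))"
  proof (rule eventually_rational_card_invariant[OF W])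
    show "orbit_triples \<O> \<O>1 \<O>2 n \<subseteq> FI_obj ?W n" if "start \<le> n" for n
      using pair_in_obj[OF \<O>(2) that] pair_in_obj[OF \<O>(3) that]
      by (auto simp: orbit_triples_def FI_obj_prod)
    show "FI_act ?W m n f x \<in> orbit_triples \<O> \<O>1 \<O>2 n"
      if "start \<le> m" "FI_emb m n f" "x \<in> orbit_triples \<O> \<O>1 \<O>2 m" for m n f x
      using that(3) pair_act[OF \<O>(1) that(1) _ that(2)] pair_act[OF \<O>(2) that(1) _ that(2)]
        pair_act[OF \<O>(3) that(1) _ that(2)]
      by (auto simp: orbit_triples_def FI_act_prod)
  qed
  then show ?thesis
    unfolding structure_constant_def
    by (intro eventually_rational_divide
        eventually_rational_card_stable_orbit[OF FI_set_ZZ fg_ZZ \<O>(1)])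
qed

text \<open>A permutation carrying \<open>(a, b)\<close> to another pair of the orbit carries the
  intermediate points along, so their number is constant on the orbit, and counting triples by their
  outer pair gives the quotient.\<close>

lemma structure_constant_eq:
  assumes \<O>: "\<O> \<in> J" "\<O>1 \<in> J" "\<O>2 \<in> J" and n: "start \<le> n" and ab: "(a, b) \<in> \<O> n"
  shows "real (card {c \<in> FI_obj Z n. (a, c) \<in> \<O>1 n \<and> (c, b) \<in> \<O>2 n}) = structure_constant \<O> \<O>1 \<O>2 n"
proof -
  define C where "C a b = {c \<in> FI_obj Z n. (a, c) \<in> \<O>1 n \<and> (c, b) \<in> \<O>2 n}" for a b
  have finC: "finite (C a b)" for a b
    using finite_FI_obj[OF FI_set] by (simp add: C_def)
  have push: "FI_act Z n n p ` C x y \<subseteq> C (FI_act Z n n p x) (FI_act Z n n p y)"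
    if p: "p permutes {1..n}" for p x y
    using pair_act[OF \<O>(2) n _ FI_emb_permutes[OF p]] pair_act[OF \<O>(3) n _ FI_emb_permutes[OF p]]
      FI_act_in[OF FI_set FI_emb_permutes[OF p]]
    by (auto simp: C_def)
  have cardC: "card (C x y) = card (C a b)" if xy: "(x, y) \<in> \<O> n" for x y
  proof -
    obtain p where p: "p permutes {1..n}" "x = FI_act Z n n p a" "y = FI_act Z n n p b"
      using pair_transitive[OF \<O>(1) n ab xy] by blast
    have inv: "inv p permutes {1..n}" by (rule permutes_inv[OF p(1)])
    have inv_ab: "FI_act Z n n (inv p) x = a" "FI_act Z n n (inv p) y = b"
      unfolding p(2,3) using FI_act_inv(1)[OF FI_set _ p(1)] pair_in_obj[OF \<O>(1) n ab] by auto
    have "bij_betw (FI_act Z n n p) (C a b) (C x y)"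
    proof (rule bij_betw_byWitness[of _ "FI_act Z n n (inv p)"])
      show "FI_act Z n n p ` C a b \<subseteq> C x y" using push[OF p(1), of a b] p(2,3) by simp
      show "FI_act Z n n (inv p) ` C x y \<subseteq> C a b" using push[OF inv, of x y] inv_ab by simp
      show "\<forall>c\<in>C a b. FI_act Z n n (inv p) (FI_act Z n n p c) = c"
        using FI_act_inv(1)[OF FI_set _ p(1)] by (simp add: C_def)
      show "\<forall>c\<in>C x y. FI_act Z n n p (FI_act Z n n (inv p) c) = c"
        using FI_act_inv(2)[OF FI_set _ p(1)] by (simp add: C_def)
    qed
    then show ?thesis by (simp add: bij_betw_same_card)
  qed
  have "orbit_triples \<O> \<O>1 \<O>2 n = (\<lambda>((x, y), c). (x, c, y)) ` (SIGMA (x, y):\<O> n. C x y)"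
    using pair_in_obj[OF \<O>(2) n] by (force simp: orbit_triples_def C_def)
  moreover have "inj_on (\<lambda>((x, y), c). (x, c, y)) (SIGMA (x, y):\<O> n. C x y)"
    by (auto simp: inj_on_def)
  ultimately have "card (orbit_triples \<O> \<O>1 \<O>2 n) = card (SIGMA (x, y):\<O> n. C x y)"
    by (simp only: card_image)
  also have "\<dots> = (\<Sum>(x, y)\<in>\<O> n. card (C x y))"
    using finite_orbit[OF \<O>(1) n] finC by (simp add: case_prod_unfold)
  also have "\<dots> = (\<Sum>(x, y)\<in>\<O> n. card (C a b))"
    using cardC by (intro sum.cong) auto
  also have "\<dots> = card (\<O> n) * card (C a b)" by (simp add: case_prod_unfold)
  finally have "card (orbit_triples \<O> \<O>1 \<O>2 n) = card (\<O> n) * card (C a b)" .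
  moreover have "card (\<O> n) \<noteq> 0" using ab finite_orbit[OF \<O>(1) n] by auto
  ultimately show ?thesis by (simp add: structure_constant_def C_def)
qed

text \<open>Stated for all large \<open>n\<close> so that it depends on the stable orbit alone: it
  decides the shape of a row of the linear system, which must not vary with
  \<open>n\<close>.\<close>

definition diagonal :: "'a family \<Rightarrow> bool" where
  "diagonal \<O> \<longleftrightarrow> (\<forall>\<^sub>F n in sequentially. \<O> n \<subseteq> Id)"

lemma eventually_diagonal:
  assumes \<O>: "\<O> \<in> J"
  shows "\<forall>\<^sub>F n in sequentially. \<forall>(a, b)\<in>\<O> n. a = b \<longleftrightarrow> diagonal \<O>"
proof (cases "diagonal \<O>")
  case True
  then have "\<forall>\<^sub>F n in sequentially. \<O> n \<subseteq> Id" by (simp add: diagonal_def)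
  then show ?thesis by eventually_elim (use True in auto)
next
  case False
  have "(\<forall>\<^sub>F n in sequentially. \<O> n \<subseteq> Id) \<or> (\<forall>\<^sub>F n in sequentially. \<not> \<O> n \<subseteq> Id)"
    by (rule stable_orbit_eventually_in[OF FI_set_ZZ fg_ZZ _ \<O>]) (auto simp: FI_act_prod)
  then have "\<forall>\<^sub>F n in sequentially. \<not> \<O> n \<subseteq> Id" using False by (simp add: diagonal_def)
  moreover have "\<forall>\<^sub>F n in sequentially. start \<le> n" by (rule eventually_ge_at_top)
  ultimately show ?thesis
  proof eventually_elim
    case (elim n)
    have "a \<noteq> b" if ab: "(a, b) \<in> \<O> n" for a b
    proof
      assume "a = b"
      have "(x, y) \<in> Id" if xy: "(x, y) \<in> \<O> n" for x y
        using pair_transitive[OF \<O> elim(2) ab xy] \<open>a = b\<close> by auto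
      then show False using elim(1) by auto
    qed
    then show ?case using False by auto
  qed
qed

text \<open>Row \<open>\<O>\<close> of the system satisfied by the moments of the hitting times, with one unknown for
  every stable orbit: the unit vector of \<open>\<O>\<close> minus one step of the chain killed at its target.\<close>

definition moment_matrix ::
  "('a family \<Rightarrow> real poly fract) \<Rightarrow> 'a family \<Rightarrow> 'a family \<Rightarrow> nat \<Rightarrow> real" where
  "moment_matrix P \<O> \<O>' n = of_bool (\<O>' = \<O>) -
     (if diagonal \<O> then 0
      else \<Sum>\<O>1\<in>J. eval_ratfun (P \<O>1) (real n) * structure_constant \<O> \<O>1 \<O>' n)"

definition orbit_function :: "('a family \<Rightarrow> real) \<Rightarrow> nat \<Rightarrow> 'a \<Rightarrow> 'a \<Rightarrow> real" where
  "orbit_function z n a b = (\<Sum>\<O>\<in>J. z \<O> * of_bool ((a, b) \<in> \<O> n))"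

lemma eventually_rational_moment_matrix:
  "\<O> \<in> J \<Longrightarrow> \<O>' \<in> J \<Longrightarrow> eventually_rational (moment_matrix P \<O> \<O>')"
  unfolding moment_matrix_def[abs_def]
  by (cases "diagonal \<O>"; simp only: if_True if_False;
      intro eventually_rational_diff eventually_rational_const eventually_rational_sum
        eventually_rational_mult eventually_rational_eval_ratfun eventually_rational_structure_constant)

text \<open>Sorting the intermediate states \<open>c\<close> by the orbits of \<open>(a, c)\<close>
  and \<open>(c, b)\<close> turns one step of the chain into structure constants, so the row depends
  only on the orbit of \<open>(a, b)\<close>.\<close>

lemma moment_matrix_row:
  assumes \<O>: "\<O> \<in> J" and n: "start \<le> n" and ab: "(a, b) \<in> \<O> n"
  shows "(\<Sum>\<O>'\<in>J. moment_matrix P \<O> \<O>' n * z \<O>') = z \<O> -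
    (if diagonal \<O> then 0 else \<Sum>c\<in>FI_obj Z n. specialize Z P n a c * orbit_function z n c b)"
proof -
  define e where "e \<O>1 = eval_ratfun (P \<O>1) (real n)" for \<O>1
  have "(\<Sum>c\<in>FI_obj Z n. specialize Z P n a c * orbit_function z n c b) =
      (\<Sum>c\<in>FI_obj Z n. \<Sum>\<O>1\<in>J. \<Sum>\<O>'\<in>J.
         e \<O>1 * z \<O>' * of_bool ((a, c) \<in> \<O>1 n \<and> (c, b) \<in> \<O>' n))"
    unfolding specialize_def orbit_function_def orbit_matrix_def sum_product e_def
    by (intro sum.cong refl) (simp add: of_bool_conj)
  also have "\<dots> = (\<Sum>\<O>1\<in>J. \<Sum>\<O>'\<in>J. \<Sum>c\<in>FI_obj Z n.
         e \<O>1 * z \<O>' * of_bool ((a, c) \<in> \<O>1 n \<and> (c, b) \<in> \<O>' n))"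
    by (subst sum.swap, intro sum.cong refl, rule sum.swap)
  also have "\<dots> = (\<Sum>\<O>1\<in>J. \<Sum>\<O>'\<in>J. e \<O>1 * z \<O>' * structure_constant \<O> \<O>1 \<O>' n)"
  proof (intro sum.cong refl)
    fix \<O>1 \<O>' assume J: "\<O>1 \<in> J" "\<O>' \<in> J"
    have "(\<Sum>c\<in>FI_obj Z n. of_bool ((a, c) \<in> \<O>1 n \<and> (c, b) \<in> \<O>' n)) =
        real (card {c \<in> FI_obj Z n. (a, c) \<in> \<O>1 n \<and> (c, b) \<in> \<O>' n})"
      using finite_FI_obj[OF FI_set] by (simp add: Int_def)
    also have "\<dots> = structure_constant \<O> \<O>1 \<O>' n"
      by (rule structure_constant_eq[OF \<O> J n ab])
    finally show "(\<Sum>c\<in>FI_obj Z n. e \<O>1 * z \<O>' * of_bool ((a, c) \<in> \<O>1 n \<and> (c, b) \<in> \<O>' n)) =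
        e \<O>1 * z \<O>' * structure_constant \<O> \<O>1 \<O>' n"
      by (simp only: sum_distrib_left[symmetric])
  qed
  also have "\<dots> = (\<Sum>\<O>'\<in>J. (\<Sum>\<O>1\<in>J. e \<O>1 * structure_constant \<O> \<O>1 \<O>' n) * z \<O>')"
    by (subst sum.swap, unfold sum_distrib_right, intro sum.cong refl) simp
  finally have step: "(\<Sum>c\<in>FI_obj Z n. specialize Z P n a c * orbit_function z n c b) =
      (\<Sum>\<O>'\<in>J. (\<Sum>\<O>1\<in>J. e \<O>1 * structure_constant \<O> \<O>1 \<O>' n) * z \<O>')" .
  have "(\<Sum>\<O>'\<in>J. of_bool (\<O>' = \<O>) * z \<O>') = (\<Sum>\<O>'\<in>J. if \<O>' = \<O> then z \<O> else 0)"
    by (intro sum.cong) auto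
  then have unit: "(\<Sum>\<O>'\<in>J. of_bool (\<O>' = \<O>) * z \<O>') = z \<O>"
    using finite_J \<O> by simp
  show ?thesis
  proof (cases "diagonal \<O>")
    case True
    then show ?thesis using unit by (simp add: moment_matrix_def)
  next
    case False
    then show ?thesis
      unfolding step moment_matrix_def e_def
      by (simp only: False if_False left_diff_distrib sum_subtractf unit)
  qed
qed

lemma orbit_function_eq:
  assumes "start \<le> n" "\<O> \<in> J" "(a, b) \<in> \<O> n"
  shows "orbit_function z n a b = z \<O>"
  unfolding orbit_function_def by (rule sum_over_orbits[OF assms])

end

section \<open>The linear systems at a single large \<open>n\<close>\<close>

lemma irreducible_matrix_cong:
  assumes eq: "\<And>a b. a \<in> S \<Longrightarrow> b \<in> S \<Longrightarrow> Q a b = Q' a b" and "irreducible_matrix S Q'"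
  shows "irreducible_matrix S Q"
proof -
  have "matrix_pow S Q t a b = matrix_pow S Q' t a b" if "a \<in> S" for t a b
    using that by (induction t arbitrary: a) (simp_all add: eq)
  then show ?thesis using assms(2) by (simp add: irreducible_matrix_def)
qed

text \<open>The choice of representative is immaterial when \<open>F\<close> is constant on
  \<open>\<O> n\<close>, as the moments are by symmetry.\<close>

definition orbit_value :: "('a \<Rightarrow> 'a \<Rightarrow> real) \<Rightarrow> nat \<Rightarrow> 'a family \<Rightarrow> real" where
  "orbit_value F n \<O> = (case SOME x. x \<in> \<O> n of (a, b) \<Rightarrow> F a b)"

text \<open>Collects for one \<open>n\<close> what holds for all large \<open>n\<close>, which frees
  the linear algebra from eventual quantifiers.\<close>

locale fg_FI_chain = fg_FI_set Z for Z :: "'a FI_data" +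
  fixes P :: "'a family \<Rightarrow> real poly fract" and n :: nat and Q :: "'a \<Rightarrow> 'a \<Rightarrow> real"
  assumes n: "stable_start (FI_prod Z Z) \<le> n"
    and diagonal_iff: "\<And>\<O> a b. \<O> \<in> stable_orbits (FI_prod Z Z) \<Longrightarrow> (a, b) \<in> \<O> n \<Longrightarrow> a = b \<longleftrightarrow> diagonal \<O>"
    and Q_eq: "\<And>a b. a \<in> FI_obj Z n \<Longrightarrow> b \<in> FI_obj Z n \<Longrightarrow> Q a b = specialize Z P n a b"
    and stochastic: "stochastic_matrix (FI_obj Z n) Q"
    and irreducible: "irreducible_matrix (FI_obj Z n) Q"
begin

abbreviation "S \<equiv> FI_obj Z n"
abbreviation "mean \<equiv> orbit_value (\<lambda>a b. hit_mean S Q b a) n"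
abbreviation "second \<equiv> orbit_value (\<lambda>a b. hit_second S Q b a) n"

lemma killed_chain: "b \<in> S \<Longrightarrow> killed_chain S Q b"
  using finite_FI_obj[OF FI_set] stochastic irreducible by unfold_locales

lemma Q_perm:
  assumes p: "p permutes {1..n}" and "a \<in> S" "b \<in> S"
  shows "Q (FI_act Z n n p a) (FI_act Z n n p b) = Q a b"
proof -
  obtain \<O> where \<O>: "\<O> \<in> J" "(a, b) \<in> \<O> n" using pair_orbit_ex[OF n assms(2,3)] .
  note emb = FI_emb_permutes[OF p]
  have "(FI_act Z n n p a, FI_act Z n n p b) \<in> \<O> n" by (rule pair_act[OF \<O>(1) n \<O>(2) emb])
  then show ?thesis
    using \<O> assms(2,3) FI_act_in[OF FI_set emb] by (simp add: Q_eq specialize_on_orbit[OF n])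
qed

lemma act_bij:
  assumes p: "p permutes {1..n}"
  shows "bij_betw (FI_act Z n n p) S S"
proof (rule bij_betw_byWitness[of _ "FI_act Z n n (inv p)"])
  note act_in = FI_act_in[OF FI_set FI_emb_permutes]
  show "FI_act Z n n p ` S \<subseteq> S" using act_in[OF p] by blast
  show "FI_act Z n n (inv p) ` S \<subseteq> S" using act_in[OF permutes_inv[OF p]] by blast
qed (use FI_act_inv[OF FI_set _ p] in simp_all)

lemma moment_on_orbit:
  assumes "\<O> \<in> J" "(a, b) \<in> \<O> n"
  shows "hit_mean S Q b a = mean \<O>" and "hit_second S Q b a = second \<O>"
proof -
  obtain a' b' where some: "(SOME x. x \<in> \<O> n) = (a', b')" by fastforce
  have "(SOME x. x \<in> \<O> n) \<in> \<O> n" using assms(2) by (rule someI)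
  then have "(a', b') \<in> \<O> n" unfolding some .
  from pair_transitive[OF assms(1) n assms(2) this]
  obtain p where p: "p permutes {1..n}" "a' = FI_act Z n n p a" "b' = FI_act Z n n p b" by metis
  note ab = pair_in_obj[OF assms(1) n assms(2)]
  show "hit_mean S Q b a = mean \<O>"
    using hit_mean_invariant[of "FI_act Z n n p" S Q a b] act_bij[OF p(1)] Q_perm[OF p(1)] ab
    by (simp add: orbit_value_def some p)
  show "hit_second S Q b a = second \<O>"
    using hit_second_invariant[of "FI_act Z n n p" S Q a b] act_bij[OF p(1)] Q_perm[OF p(1)] ab
    by (simp add: orbit_value_def some p)
qed

lemma orbit_function_moment:
  assumes "a \<in> S" "b \<in> S"
  shows "orbit_function mean n a b = hit_mean S Q b a"
    and "orbit_function second n a b = hit_second S Q b a"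
proof -
  obtain \<O> where \<O>: "\<O> \<in> J" "(a, b) \<in> \<O> n" using pair_orbit_ex[OF n assms] .
  show "orbit_function mean n a b = hit_mean S Q b a"
    "orbit_function second n a b = hit_second S Q b a"
    using moment_on_orbit[OF \<O>] orbit_function_eq[OF n \<O>] by simp_all
qed

lemma row_pair:
  assumes \<O>: "\<O> \<in> J"
  shows "\<exists>a b. (a, b) \<in> \<O> n \<and> a \<in> S \<and> b \<in> S \<and>
    (\<forall>z. (\<Sum>\<O>'\<in>J. moment_matrix P \<O> \<O>' n * z \<O>') =
      z \<O> - (if a = b then 0 else \<Sum>c\<in>S. Q a c * orbit_function z n c b))"
proof -
  obtain a b where ab: "(a, b) \<in> \<O> n"
    using stable_orbit_nonempty[OF FI_set_ZZ fg_ZZ \<O> n] by auto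
  note in_S = pair_in_obj[OF \<O> n ab]
  have "(\<Sum>\<O>'\<in>J. moment_matrix P \<O> \<O>' n * z \<O>') =
      z \<O> - (if a = b then 0 else \<Sum>c\<in>S. Q a c * orbit_function z n c b)" for z
    unfolding moment_matrix_row[OF \<O> n ab] diagonal_iff[OF \<O> ab] using in_S by (simp add: Q_eq)
  then show ?thesis using ab in_S by (intro exI[of _ a] exI[of _ b]) simp
qed

lemma mean_row:
  assumes "\<O> \<in> J"
  shows "(\<Sum>\<O>'\<in>J. moment_matrix P \<O> \<O>' n * mean \<O>') = of_bool (\<not> diagonal \<O>)"
proof -
  obtain a b where ab: "(a, b) \<in> \<O> n" "a \<in> S" "b \<in> S"
    and row: "\<forall>z. (\<Sum>\<O>'\<in>J. moment_matrix P \<O> \<O>' n * z \<O>') =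
      z \<O> - (if a = b then 0 else \<Sum>c\<in>S. Q a c * orbit_function z n c b)"
    using row_pair[OF assms] by (elim exE conjE)
  have "(\<Sum>c\<in>S. Q a c * orbit_function mean n c b) = (\<Sum>c\<in>S. Q a c * hit_mean S Q b c)"
    using ab(3) by (intro sum.cong) (simp_all add: orbit_function_moment)
  moreover have "mean \<O> = hit_mean S Q b a" using moment_on_orbit(1)[OF assms ab(1)] by simp
  moreover have "hit_mean S Q b a = of_bool (a \<noteq> b) + killed_step S Q b (hit_mean S Q b) a"
    by (rule killed_chain.H_eq[OF killed_chain[OF ab(3)] ab(2)])
  ultimately show ?thesis
    unfolding row[rule_format] diagonal_iff[OF assms ab(1), symmetric] by (simp add: killed_step_def)
qed

lemma second_row:
  assumes "\<O> \<in> J"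
  shows "(\<Sum>\<O>'\<in>J. moment_matrix P \<O> \<O>' n * second \<O>') = mean \<O>"
proof -
  obtain a b where ab: "(a, b) \<in> \<O> n" "a \<in> S" "b \<in> S"
    and row: "\<forall>z. (\<Sum>\<O>'\<in>J. moment_matrix P \<O> \<O>' n * z \<O>') =
      z \<O> - (if a = b then 0 else \<Sum>c\<in>S. Q a c * orbit_function z n c b)"
    using row_pair[OF assms] by (elim exE conjE)
  have "(\<Sum>c\<in>S. Q a c * orbit_function second n c b) = (\<Sum>c\<in>S. Q a c * hit_second S Q b c)"
    using ab(3) by (intro sum.cong) (simp_all add: orbit_function_moment)
  moreover have "mean \<O> = hit_mean S Q b a" "second \<O> = hit_second S Q b a"
    using moment_on_orbit[OF assms ab(1)] by simp_all
  moreover have "hit_second S Q b a = hit_mean S Q b a + killed_step S Q b (hit_second S Q b) a"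
    by (rule killed_chain.K_eq[OF killed_chain[OF ab(3)] ab(2)])
  ultimately show ?thesis unfolding row[rule_format] by (simp add: killed_step_def)
qed

text \<open>For a fixed target \<open>b\<close> the function of the state obtained from
  \<open>z\<close> vanishes at \<open>b\<close> and is harmonic elsewhere. Harmonicity at a state
  \<open>x\<close> is the row of the orbit of \<open>(x, b)\<close>, which is why all rows must
  vanish to conclude for a single coordinate.\<close>

lemma moment_matrix_kernel:
  assumes kernel: "\<And>\<O>. \<O> \<in> J \<Longrightarrow> (\<Sum>\<O>'\<in>J. moment_matrix P \<O> \<O>' n * z \<O>') = 0" and \<O>: "\<O> \<in> J"
  shows "z \<O> = 0"
proof -
  obtain a b where ab: "(a, b) \<in> \<O> n" "a \<in> S" "b \<in> S"
    using row_pair[OF \<O>] by (elim exE conjE)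
  have eq: "orbit_function z n x b = (if x = b then 0 else \<Sum>c\<in>S. Q x c * orbit_function z n c b)"
    if x: "x \<in> S" for x
  proof -
    obtain \<O>' where \<O>': "\<O>' \<in> J" "(x, b) \<in> \<O>' n" using pair_orbit_ex[OF n x ab(3)] .
    have "(\<Sum>c\<in>S. specialize Z P n x c * orbit_function z n c b) =
        (\<Sum>c\<in>S. Q x c * orbit_function z n c b)"
      using x by (simp add: Q_eq)
    then show ?thesis
      using kernel[OF \<O>'(1)]
      unfolding moment_matrix_row[OF \<O>'(1) n \<O>'(2)] orbit_function_eq[OF n \<O>']
        diagonal_iff[OF \<O>', symmetric] by simp
  qed
  have "orbit_function z n a b = 0"
  proof (rule killed_chain.harmonic_zero[OF killed_chain[OF ab(3)] _ _ ab(2)])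
    show "orbit_function z n b b = 0" using eq[OF ab(3)] by simp
    show "orbit_function z n x b = (\<Sum>c\<in>S. Q x c * orbit_function z n c b)"
      if "x \<in> S" "x \<noteq> b" for x using eq[OF that(1)] that(2) by simp
  qed
  then show ?thesis using orbit_function_eq[OF n \<O> ab(1)] by simp
qed

end

theorem theorem4p16:
  fixes Z :: "'a FI_data"
    and M :: "nat \<Rightarrow> 'a \<Rightarrow> 'w measure"
    and X :: "nat \<Rightarrow> nat \<Rightarrow> 'w \<Rightarrow> 'a"
    and P :: "'a family \<Rightarrow> real poly fract"
  assumes "FI_set Z" and "finitely_generated Z"
    and "FI_markov_chain Z M X P" and "connected_chain Z P"
  shows "(\<exists>V. virtual_relation Z V \<and>
            (\<forall>\<^sub>F n in sequentially. \<forall>a\<in>FI_obj Z n. \<forall>b\<in>FI_obj Z n.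
               has_variance (M n a) (hitting_time (X n) b) (specialize Z V n a b))) \<and>
         (\<forall>\<O>\<in>stable_orbits (FI_prod Z Z). \<exists>R :: real poly fract.
            \<forall>\<^sub>F n in sequentially. \<forall>(a, b)\<in>\<O> n.
               has_variance (M n a) (hitting_time (X n) b) (eval_ratfun R (real n)))"
proof -
  interpret fg_FI_set Z using assms(1,2) by unfold_locales
  obtain Q where stoch: "\<And>n. stochastic_matrix (FI_obj Z n) (Q n)"
    and chain: "\<And>n a. a \<in> FI_obj Z n \<Longrightarrow> markov_chain_from (FI_obj Z n) (Q n) a (M n a) (X n)"
    and Q: "\<forall>\<^sub>F n in sequentially. \<forall>a\<in>FI_obj Z n. \<forall>b\<in>FI_obj Z n. Q n a b = specialize Z P n a b"
    using assms(3) unfolding FI_markov_chain_def by blast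
  have "\<forall>\<^sub>F n in sequentially. start \<le> n" by (rule eventually_ge_at_top)
  moreover have "\<forall>\<^sub>F n in sequentially. \<forall>\<O>\<in>J. \<forall>(a, b)\<in>\<O> n. a = b \<longleftrightarrow> diagonal \<O>"
    by (intro eventually_ball_finite finite_J ballI eventually_diagonal)
  moreover have "\<forall>\<^sub>F n in sequentially. irreducible_matrix (FI_obj Z n) (specialize Z P n)"
    using assms(4) by (simp add: connected_chain_def)
  ultimately have ev: "\<forall>\<^sub>F n in sequentially. fg_FI_chain Z P n (Q n)"
    using Q
  proof eventually_elim
    case (elim n)
    show ?case
    proof
      show "start \<le> n" by (rule elim(1))
      show "a = b \<longleftrightarrow> diagonal \<O>" if "\<O> \<in> J" "(a, b) \<in> \<O> n" for \<O> a b
        using elim(2) that by auto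
      show eq: "Q n a b = specialize Z P n a b" if "a \<in> FI_obj Z n" "b \<in> FI_obj Z n" for a b
        using elim(4) that by blast
      show "stochastic_matrix (FI_obj Z n) (Q n)" by (rule stoch)
      show "irreducible_matrix (FI_obj Z n) (Q n)"
        by (rule irreducible_matrix_cong[OF eq elim(3)])
    qed
  qed
  define mean where "mean \<O> n = orbit_value (\<lambda>a b. hit_mean (FI_obj Z n) (Q n) b a) n \<O>" for \<O> n
  define second where "second \<O> n = orbit_value (\<lambda>a b. hit_second (FI_obj Z n) (Q n) b a) n \<O>" for \<O> n
  \<comment> \<open>Irreducibility gives this at each large \<open>n\<close>; the elimination asks
    for nothing uniform.\<close>
  have unique: "\<forall>\<^sub>F n in sequentially. \<forall>z.
      (\<forall>\<O>\<in>J. (\<Sum>\<O>'\<in>J. moment_matrix P \<O> \<O>' n * z \<O>') = 0) \<longrightarrow> (\<forall>\<O>\<in>J. z \<O> = 0)"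
    using ev by eventually_elim (use fg_FI_chain.moment_matrix_kernel in blast)
  have mean_rational: "eventually_rational (mean \<O>)" if "\<O> \<in> J" for \<O>
  proof (rule eventually_rational_unique_solution[OF finite_J finite_J
        eventually_rational_moment_matrix _ _ unique that])
    show "eventually_rational (\<lambda>_. of_bool (\<not> diagonal \<O>'))" for \<O>'
      by (rule eventually_rational_const)
    show "\<forall>\<^sub>F n in sequentially. \<forall>\<O>\<in>J.
        (\<Sum>\<O>'\<in>J. moment_matrix P \<O> \<O>' n * mean \<O>' n) = of_bool (\<not> diagonal \<O>)"
      using ev by eventually_elim (simp add: fg_FI_chain.mean_row mean_def)
  qed
  \<comment> \<open>The matrix is the same, but the mean is now the right-hand side, so its
    rationality has to come first.\<close>
  have second_rational: "eventually_rational (second \<O>)" if "\<O> \<in> J" for \<O>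
  proof (rule eventually_rational_unique_solution[OF finite_J finite_J
        eventually_rational_moment_matrix mean_rational _ unique that])
    show "\<forall>\<^sub>F n in sequentially. \<forall>\<O>\<in>J.
        (\<Sum>\<O>'\<in>J. moment_matrix P \<O> \<O>' n * second \<O>' n) = mean \<O> n"
      using ev by eventually_elim (simp add: fg_FI_chain.second_row mean_def second_def)
  qed
  have "\<exists>r. \<forall>\<^sub>F n in sequentially. 2 * second \<O> n - mean \<O> n - (mean \<O> n)\<^sup>2 = eval_ratfun r (real n)"
    if "\<O> \<in> J" for \<O>
    unfolding power2_eq_square eventually_rational_iff_eval_ratfun[symmetric] using that
    by (intro eventually_rational_diff eventually_rational_mult eventually_rational_const
        mean_rational second_rational)
  then obtain r where r: "\<And>\<O>. \<O> \<in> J \<Longrightarrow> \<forall>\<^sub>F n in sequentially.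
      2 * second \<O> n - mean \<O> n - (mean \<O> n)\<^sup>2 = eval_ratfun (r \<O>) (real n)"
    by metis
  \<comment> \<open>A virtual relation must vanish off the stable orbits. At a pair
    \<open>(a, b)\<close> its specialization reduces to the coefficient of the one orbit containing
    the pair.\<close>
  define V where "V \<O> = (if \<O> \<in> J then r \<O> else 0)" for \<O>
  have "\<forall>\<^sub>F n in sequentially. \<forall>\<O>\<in>J.
      2 * second \<O> n - mean \<O> n - (mean \<O> n)\<^sup>2 = eval_ratfun (V \<O>) (real n)"
    using r by (intro eventually_ball_finite finite_J ballI) (simp add: V_def)
  with ev have main: "\<forall>\<^sub>F n in sequentially. \<forall>\<O>\<in>J. \<forall>(a, b)\<in>\<O> n.
      has_variance (M n a) (hitting_time (X n) b) (eval_ratfun (V \<O>) (real n))"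
  proof eventually_elim
    case (elim n)
    interpret chain_n: fg_FI_chain Z P n "Q n" by (rule elim(1))
    have "has_variance (M n a) (hitting_time (X n) b) (eval_ratfun (V \<O>) (real n))"
      if \<O>: "\<O> \<in> J" "(a, b) \<in> \<O> n" for \<O> a b
    proof -
      note ab = pair_in_obj[OF \<O>(1) chain_n.n \<O>(2)]
      have "eval_ratfun (V \<O>) (real n) = 2 * second \<O> n - mean \<O> n - (mean \<O> n)\<^sup>2"
        using elim(2) \<O>(1) by simp
      moreover have "mean \<O> n = hit_mean (FI_obj Z n) (Q n) b a"
        "second \<O> n = hit_second (FI_obj Z n) (Q n) b a"
        using chain_n.moment_on_orbit[OF \<O>] by (simp_all add: mean_def second_def)
      ultimately show ?thesis
        using hitting_time_has_variance[OF chain[OF ab(1)] finite_FI_obj[OF FI_set] ab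
            chain_n.stochastic chain_n.irreducible] by simp
    qed
    then show ?case by blast
  qed
  have "\<forall>\<^sub>F n in sequentially. \<forall>a\<in>FI_obj Z n. \<forall>b\<in>FI_obj Z n.
      has_variance (M n a) (hitting_time (X n) b) (specialize Z V n a b)"
    using ev main
  proof eventually_elim
    case (elim n)
    note n = fg_FI_chain.n[OF elim(1)]
    show ?case
    proof (intro ballI)
      fix a b assume "a \<in> FI_obj Z n" "b \<in> FI_obj Z n"
      then obtain \<O> where \<O>: "\<O> \<in> J" "(a, b) \<in> \<O> n" using pair_orbit_ex[OF n] by metis
      show "has_variance (M n a) (hitting_time (X n) b) (specialize Z V n a b)"
        unfolding specialize_on_orbit[OF n \<O>] using elim(2) \<O> by blast
    qed
  qed
  moreover have "virtual_relation Z V" by (simp add: virtual_relation_def V_def)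
  \<comment> \<open>The coefficient of \<open>\<O>\<close> in \<open>V\<close> is itself the
    rational function asked for.\<close>
  moreover have "\<forall>\<O>\<in>J. \<exists>R. \<forall>\<^sub>F n in sequentially. \<forall>(a, b)\<in>\<O> n.
      has_variance (M n a) (hitting_time (X n) b) (eval_ratfun R (real n))"
  proof
    fix \<O> assume \<O>: "\<O> \<in> J"
    have "\<forall>\<^sub>F n in sequentially. \<forall>(a, b)\<in>\<O> n.
        has_variance (M n a) (hitting_time (X n) b) (eval_ratfun (V \<O>) (real n))"
      using main
    proof eventually_elim
      case (elim n)
      then show ?case using \<O> by (rule bspec)
    qed
    then show "\<exists>R. \<forall>\<^sub>F n in sequentially. \<forall>(a, b)\<in>\<O> n.
        has_variance (M n a) (hitting_time (X n) b) (eval_ratfun R (real n))" ..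
  qed
  ultimately show ?thesis by (intro conjI exI[of _ V])
qed

end
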